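(* Let $(u,\boldsymbol q)\in H^1(\Omega)\times\boldsymbol H(\mathrm{div},\Omega)$ solve the Helmholtz problem, let $(u_h,\boldsymbol q_h)\in\mathcal P_p(\mathcal T_h)\times\boldsymbol{\mathcal P}_p(\mathcal T_h)$ be (the volume components of) the solution of the HDG scheme, and let $(r_h^\pm,\nu_h^\pm)\in\mathcal P_{p+2}(\mathcal T_h)\times\mathcal P_{p+1}(\mathcal T_h)$ solve the local saddle-point problems (all defined in the context). Then, for all $K\in\mathcal T_h$ and all $h>0$, $$\eta_K^\pm\le\sqrt6\,\mathrm e_K^\pm .$$
   Context: Every formula with $\pm$ is understood separately for the sign $+$ and for the sign $-$. Functions and polynomials are complex-valued and boldface denotes $d$-component vector fields. Domain and mesh. $d\in\{2,3\}$, $\Omega\subset\mathbb R^d$ is a bounded Lipschitz domain with polygonal/polyhedral boundary $\Gamma$ partitioned into two disjoint relatively open sets $\Gamma_D$ and $\Gamma_R$. $\{\mathcal T_h\}_{h>0}$ is a shape-regular family of conforming simplicial meshes of $\Omega$ (two elements meet in the empty set, a common vertex, a common edge or a common face). $h_K$ is the diameter of $K\in\mathcal T_h$, $h:=\max_K h_K$, and $h_F$ is the diameter of a face (edge if $d=2$) $F$. $\mathcal F_h$ is the set of all faces, split into interior faces $\mathcal F_h^I$, faces $\mathcal F_h^D$ on $\Gamma_D$ and faces $\mathcal F_h^R$ on $\Gamma_R$. For $K\in\mathcal T_h$, $\mathcal F_K:=\{F\in\mathcal F_h:F\subset\partial K\}$ and $\mathcal F_K^\star:=\mathcal F_K\cap\mathcal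 F_h^\star$, $\star\in\{I,D,R\}$. Discrete spaces. $\mathcal P_k(\mathcal T_h)$, $\boldsymbol{\mathcal P}_k(\mathcal T_h)$ are the (discontinuous) piecewise polynomial scalar and vector functions of degree at most $k$ on each $K$; $\mathcal P_k(\mathcal F_h)$ are the piecewise polynomials of degree at most $k$ on each $F\in\mathcal F_h$. $p\ge1$ is a fixed integer. $(\cdot,\cdot)_K$, $\langle\cdot,\cdot\rangle_{\partial K}$ are $L^2$ inner products; $(\cdot,\cdot)_{\mathcal T_h}:=\sum_K(\cdot,\cdot)_K$, $\langle\cdot,\cdot\rangle_{\partial\mathcal T_h}:=\sum_K\langle\cdot,\cdot\rangle_{\partial K}$, $\langle\cdot,\cdot\rangle_{\partial\mathcal T_h\setminus\Gamma}:=\sum_K\langle\cdot,\cdot\rangle_{\partial K\setminus\Gamma}$, and $\langle\cdot,\cdot\rangle_{\Gamma_\star}$ is the sum of the $L^2(F)$ inner products over $F\in\mathcal F_h^\star$. Helmholtz problem. $\omega>0$ is the wavenumber, $f\in L^2(\Omega)$, $g\in L^2(\Gamma_R)$ complex-valued. $(u,\boldsymbol q)$ satisfies $\boldsymbol q+\nabla u=0$ and $\nabla\cdot\boldsymbol q-\omega^2u=f$ in $\Omega$, $u=0$ on $\Gamma_D$, $-\boldsymbol q\cdot\boldsymbol n+i\omega u=g$ on $\Gamma_R$. HDG scheme. $(\boldsymbol q_h,u_h,\widehat u_h)\in\boldsymbol{\mathcal P}_p(\mathcal T_h)\times\mathcal P_p(\mathcal T_h)\times\mathcal P_p(\mathcal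 F_h)$ satisfies, for all $(\boldsymbol v_h,w_h,\mu_h)$ in the same product space, $(\boldsymbol q_h,\boldsymbol v_h)_{\mathcal T_h}-(u_h,\nabla\cdot\boldsymbol v_h)_{\mathcal T_h}+\langle\widehat u_h,\boldsymbol v_h\cdot\boldsymbol n\rangle_{\partial\mathcal T_h}=0$; $-\omega^2(u_h,w_h)_{\mathcal T_h}-(\boldsymbol q_h,\nabla w_h)_{\mathcal T_h}+\langle\widehat{\boldsymbol q}_h\cdot\boldsymbol n,w_h\rangle_{\partial\mathcal T_h}=(f,w_h)_{\mathcal T_h}$; $\langle\widehat{\boldsymbol q}_h\cdot\boldsymbol n,\mu_h\rangle_{\partial\mathcal T_h\setminus\Gamma}=0$; $\langle-\widehat{\boldsymbol q}_h\cdot\boldsymbol n+i\omega\widehat u_h,\mu_h\rangle_{\Gamma_R}=\langle g,\mu_h\rangle_{\Gamma_R}$; $\langle\widehat u_h,\mu_h\rangle_{\Gamma_D}=0$; where $\widehat{\boldsymbol q}_h\cdot\boldsymbol n:=\boldsymbol q_h\cdot\boldsymbol n+\tau(u_h-\widehat u_h)$ on $\partial\mathcal T_h$ and $\tau$ is a stabilization function, constant on each face of each $\partial K$, with $\tau\ge0$ and $\tau|_{\partial K}\ne0$ for all $K$. Local forms and norms. $(w,v)_{1,K}:=\omega^2(w,v)_K+(\nabla w,\nabla v)_K$, $\|w\|_{1,K}^2:=\omega^2\|w\|_K^2+\|\nabla w\|_K^2$. For $w,v\in H^1(K)$: $b_K^\pm(w,v):=(\nabla w,\nabla v)_K\pm\omega^2(w,v)_K$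 and $g_K^\pm(v):=-(\boldsymbol q_h,\nabla v)_K\pm\omega^2(u_h,v)_K$. Local saddle-point problems. For each $K\in\mathcal T_h$, $r_K^\pm:=r_h^\pm|_K$ and $\nu_K^\pm:=\nu_h^\pm|_K$ solve $(r_K^\pm,v_K)_{1,K}+b_K^\pm(\nu_K^\pm,v_K)=g_K^\pm(v_K)$ for all $v_K\in\mathcal P_{p+2}(K)$, and $b_K^\pm(w_K,r_K^\pm)=0$ for all $w_K\in\mathcal P_{p+1}(K)$. Jumps. For $F=\partial K^+\cap\partial K^-$ interior, $[\![w]\!]_F:=w|_{K^+}-w|_{K^-}$ (with the normal of $F$ pointing from $K^+$ to $K^-$), and $[\![w]\!]_F:=w|_F$ on boundary faces. $|w|_{J,K}^2:=\sum_{F\in\mathcal F_K^I\cup\mathcal F_K^D}h_F^{-1}\|[\![w]\!]\|_F^2+\sum_{F\in\mathcal F_K^R}\omega^2h_F\|w\|_F^2$, $\|w\|_{1,J,K}^2:=\|w\|_{1,K}^2+|w|_{J,K}^2$. Indicator and error. $(\eta_K^\pm)^2:=\|r_h^\pm\|_{1,K}^2+\|\boldsymbol q_h+\nabla\nu_h^\pm\|_K^2+\omega^2\|u_h-\nu_h^\pm\|_K^2$ and $(\mathrm e_K^\pm)^2:=\|u-\nu_h^\pm\|_{1,J,K}^2+\omega^2\|u-u_h\|_K^2+\|\boldsymbol q-\boldsymbol q_h\|_K^2$, with $\eta_K^\pm,\mathrm e_K^\pm\ge0$. *)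

theory Defs
  imports "HOL-Analysis.Analysis"
begin

section \<open>Lebesgue spaces and surface measure\<close>

definition L2 :: "'a measure \<Rightarrow> ('a \<Rightarrow> 'b::euclidean_space) \<Rightarrow> bool" where
  "L2 M f \<longleftrightarrow> f \<in> borel_measurable M \<and> integrable M (\<lambda>x. (norm (f x))\<^sup>2)"

text \<open>The norm serves scalar fields and, with the Euclidean norm of \<open>complex^'d\<close>, vector fields.\<close>

definition l2norm :: "'a measure \<Rightarrow> ('a \<Rightarrow> 'b::euclidean_space) \<Rightarrow> real" where
  "l2norm M f = sqrt (\<integral>x. (norm (f x))\<^sup>2 \<partial>M)"

definition ip :: "'a measure \<Rightarrow> ('a \<Rightarrow> complex) \<Rightarrow> ('a \<Rightarrow> complex) \<Rightarrow> complex" where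
  "ip M f g = (\<integral>x. f x * cnj (g x) \<partial>M)"

definition ipv :: "'a measure \<Rightarrow> ('a \<Rightarrow> complex^'d) \<Rightarrow> ('a \<Rightarrow> complex^'d) \<Rightarrow> complex" where
  "ipv M f g = (\<integral>x. (\<Sum>i\<in>UNIV. f x $ i * cnj (g x $ i)) \<partial>M)"

text \<open>
  The surface measure is the \<open>(d-1)\<close>-dimensional Hausdorff measure, normalised to agree with
  \<open>(d-1)\<close>-dimensional Lebesgue measure on hyperplanes. It is completed, in analogy with
  \<^const>\<open>lebesgue\<close>.
\<close>

definition hausdorff_outer :: "(real^'d) set \<Rightarrow> ennreal" where
  "hausdorff_outer A =
     (SUP \<delta>\<in>{0::real<..}.
        INF C\<in>{C :: nat \<Rightarrow> (real^'d) set. A \<subseteq> (\<Union>i. C i) \<and> (\<forall>i. bounded (C i) \<and> diameter (C i) \<le> \<delta>)}.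
          (\<Sum>i. ennreal (unit_ball_vol (real (CARD('d) - 1)) * (diameter (C i) / 2) ^ (CARD('d) - 1))))"

definition surface_measure :: "(real^'d) measure" where
  "surface_measure = completion (measure_of UNIV (sets borel) hausdorff_outer)"

definition surface_on :: "(real^'d) set \<Rightarrow> (real^'d) measure" where
  "surface_on B = restrict_space surface_measure B"

section \<open>Weak derivatives, Sobolev spaces and traces\<close>

primrec Ck :: "nat \<Rightarrow> (real^'d \<Rightarrow> 'b::real_normed_vector) \<Rightarrow> bool" where
  "Ck 0 \<phi> \<longleftrightarrow> continuous_on UNIV \<phi>"
| "Ck (Suc k) \<phi> \<longleftrightarrow> (\<forall>x. \<phi> differentiable (at x)) \<and>
     (\<forall>i. Ck k (\<lambda>x. frechet_derivative \<phi> (at x) (axis i 1)))"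

definition Cinf :: "(real^'d \<Rightarrow> 'b::real_normed_vector) \<Rightarrow> bool" where
  "Cinf \<phi> \<longleftrightarrow> (\<forall>k. Ck k \<phi>)"

definition test_function :: "(real^'d) set \<Rightarrow> (real^'d \<Rightarrow> real) \<Rightarrow> bool" where
  "test_function S \<phi> \<longleftrightarrow> Cinf \<phi> \<and> compact (closure {x. \<phi> x \<noteq> 0}) \<and> closure {x. \<phi> x \<noteq> 0} \<subseteq> S"

definition partial :: "'d \<Rightarrow> (real^'d \<Rightarrow> real) \<Rightarrow> real^'d \<Rightarrow> real" where
  "partial i \<phi> x = frechet_derivative \<phi> (at x) (axis i 1)"

definition locally_integrable :: "(real^'d) set \<Rightarrow> (real^'d \<Rightarrow> 'b::euclidean_space) \<Rightarrow> bool" where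
  "locally_integrable S f \<longleftrightarrow> (\<forall>C. compact C \<and> C \<subseteq> S \<longrightarrow> set_integrable lebesgue C f)"

definition has_weak_grad ::
    "(real^'d) set \<Rightarrow> (real^'d \<Rightarrow> complex) \<Rightarrow> (real^'d \<Rightarrow> complex^'d) \<Rightarrow> bool" where
  "has_weak_grad S u G \<longleftrightarrow> locally_integrable S u \<and> locally_integrable S G \<and>
     (\<forall>\<phi> i. test_function S \<phi> \<longrightarrow>
        (\<integral>x. partial i \<phi> x *\<^sub>R u x \<partial>lebesgue_on S) = - (\<integral>x. \<phi> x *\<^sub>R G x $ i \<partial>lebesgue_on S))"

definition has_weak_div ::
    "(real^'d) set \<Rightarrow> (real^'d \<Rightarrow> complex^'d) \<Rightarrow> (real^'d \<Rightarrow> complex) \<Rightarrow> bool" where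
  "has_weak_div S q D \<longleftrightarrow> locally_integrable S q \<and> locally_integrable S D \<and>
     (\<forall>\<phi>. test_function S \<phi> \<longrightarrow>
        (\<integral>x. (\<Sum>i\<in>UNIV. partial i \<phi> x *\<^sub>R q x $ i) \<partial>lebesgue_on S)
          = - (\<integral>x. \<phi> x *\<^sub>R D x \<partial>lebesgue_on S))"

text \<open>The weak gradient and divergence on an open set are determined almost everywhere; the
  following pick one representative.\<close>

definition wgrad :: "(real^'d) set \<Rightarrow> (real^'d \<Rightarrow> complex) \<Rightarrow> real^'d \<Rightarrow> complex^'d" where
  "wgrad S u = (SOME G. has_weak_grad S u G)"

definition wdiv :: "(real^'d) set \<Rightarrow> (real^'d \<Rightarrow> complex^'d) \<Rightarrow> real^'d \<Rightarrow> complex" where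
  "wdiv S q = (SOME D. has_weak_div S q D)"

definition H1 :: "(real^'d) set \<Rightarrow> (real^'d \<Rightarrow> complex) \<Rightarrow> bool" where
  "H1 S u \<longleftrightarrow> L2 (lebesgue_on S) u \<and> (\<exists>G. has_weak_grad S u G \<and> L2 (lebesgue_on S) G)"

definition Hdiv :: "(real^'d) set \<Rightarrow> (real^'d \<Rightarrow> complex^'d) \<Rightarrow> bool" where
  "Hdiv S q \<longleftrightarrow> L2 (lebesgue_on S) q \<and> (\<exists>D. has_weak_div S q D \<and> L2 (lebesgue_on S) D)"

text \<open>
  For a bounded Lipschitz domain \<open>S\<close> and a part \<open>B\<close> of its boundary, the trace on \<open>B\<close> is the
  continuous extension of the restriction map from smooth functions, dense in \<open>H\<^sup>1(S)\<close>, to \<open>L\<^sup>2(B)\<close>.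
\<close>

definition has_trace ::
    "(real^'d) set \<Rightarrow> (real^'d) set \<Rightarrow> (real^'d \<Rightarrow> complex) \<Rightarrow> (real^'d \<Rightarrow> complex) \<Rightarrow> bool" where
  "has_trace S B w t \<longleftrightarrow> H1 S w \<and> L2 (surface_on B) t \<and>
     (\<exists>\<phi> :: nat \<Rightarrow> real^'d \<Rightarrow> complex. (\<forall>n. Cinf (\<phi> n)) \<and>
        (\<lambda>n. l2norm (lebesgue_on S) (\<lambda>x. \<phi> n x - w x)) \<longlonglongrightarrow> 0 \<and>
        (\<lambda>n. l2norm (lebesgue_on S) (wgrad S (\<lambda>x. \<phi> n x - w x))) \<longlonglongrightarrow> 0 \<and>
        (\<lambda>n. l2norm (surface_on B) (\<lambda>x. \<phi> n x - t x)) \<longlonglongrightarrow> 0)"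

definition trace :: "(real^'d) set \<Rightarrow> (real^'d) set \<Rightarrow> (real^'d \<Rightarrow> complex) \<Rightarrow> real^'d \<Rightarrow> complex" where
  "trace S B w = (SOME t. has_trace S B w t)"

section \<open>Domain and mesh\<close>

definition lipschitz_domain :: "(real^'d) set \<Rightarrow> bool" where
  "lipschitz_domain S \<longleftrightarrow> open S \<and> connected S \<and> S \<noteq> {} \<and> bounded S \<and>
     (\<forall>x\<in>frontier S. \<exists>e \<rho> L \<phi>. norm e = 1 \<and> \<rho> > 0 \<and> L-lipschitz_on {z. z \<bullet> e = 0} \<phi> \<and>
        (\<forall>y\<in>ball x \<rho>. y \<in> S \<longleftrightarrow> y \<bullet> e < \<phi> (y - (y \<bullet> e) *\<^sub>R e)))"

definition polyhedral_boundary :: "(real^'d) set \<Rightarrow> bool" where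
  "polyhedral_boundary S \<longleftrightarrow>
     (\<exists>P. finite P \<and> (\<forall>A\<in>P. polytope A \<and> aff_dim A = int CARD('d) - 1) \<and> frontier S = \<Union>P)"

text \<open>Two disjoint relatively open parts cover a connected boundary only up to their common
  relative boundary; hence the boundary is covered up to a set of surface measure zero.\<close>

definition boundary_partition :: "(real^'d) set \<Rightarrow> (real^'d) set \<Rightarrow> (real^'d) set \<Rightarrow> bool" where
  "boundary_partition \<Omega> \<Gamma>D \<Gamma>R \<longleftrightarrow> \<Gamma>D \<inter> \<Gamma>R = {} \<and>
     openin (top_of_set (frontier \<Omega>)) \<Gamma>D \<and> openin (top_of_set (frontier \<Omega>)) \<Gamma>R \<and>
     emeasure surface_measure (frontier \<Omega> - (\<Gamma>D \<union> \<Gamma>R)) = 0"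

definition faces :: "(real^'d) set set \<Rightarrow> (real^'d) set set" where
  "faces \<T> = {F. \<exists>K\<in>\<T>. F facet_of K}"

definition interior_faces :: "(real^'d) set set \<Rightarrow> (real^'d) set set" where
  "interior_faces \<T> = {F. \<exists>K\<in>\<T>. \<exists>K'\<in>\<T>. K \<noteq> K' \<and> F facet_of K \<and> F facet_of K'}"

definition faces_on :: "(real^'d) set \<Rightarrow> (real^'d) set set \<Rightarrow> (real^'d) set set" where
  "faces_on \<Gamma> \<T> = {F\<in>faces \<T>. F \<subseteq> closure \<Gamma>}"

definition faces_of :: "(real^'d) set set \<Rightarrow> (real^'d) set \<Rightarrow> (real^'d) set set" where
  "faces_of \<T> K = {F\<in>faces \<T>. F \<subseteq> frontier K}"

definition mesh :: "(real^'d) set \<Rightarrow> (real^'d) set \<Rightarrow> (real^'d) set \<Rightarrow> (real^'d) set set \<Rightarrow> bool" where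
  "mesh \<Omega> \<Gamma>D \<Gamma>R \<T> \<longleftrightarrow> triangulation \<T> \<and> (\<forall>K\<in>\<T>. int CARD('d) simplex K) \<and>
     \<Union>\<T> = closure \<Omega> \<and>
     faces \<T> = interior_faces \<T> \<union> faces_on \<Gamma>D \<T> \<union> faces_on \<Gamma>R \<T>"

definition mesh_size :: "(real^'d) set set \<Rightarrow> real" where
  "mesh_size \<T> = Max (diameter ` \<T>)"

text \<open>A family of meshes is indexed by its mesh sizes, which form some set \<open>H\<close> of positive reals
  (no mesh of a bounded domain has an arbitrarily large mesh size).\<close>

definition mesh_family ::
    "(real^'d) set \<Rightarrow> (real^'d) set \<Rightarrow> (real^'d) set \<Rightarrow> real set \<Rightarrow> (real \<Rightarrow> (real^'d) set set) \<Rightarrow> bool" where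
  "mesh_family \<Omega> \<Gamma>D \<Gamma>R H \<T> \<longleftrightarrow> H \<subseteq> {0<..} \<and>
     (\<forall>h\<in>H. mesh \<Omega> \<Gamma>D \<Gamma>R (\<T> h) \<and> mesh_size (\<T> h) = h)"

definition shape_regular :: "real set \<Rightarrow> (real \<Rightarrow> (real^'d) set set) \<Rightarrow> bool" where
  "shape_regular H \<T> \<longleftrightarrow> (\<exists>\<kappa>>0. \<forall>h\<in>H. \<forall>K\<in>\<T> h. \<exists>x \<rho>. \<rho> > 0 \<and> cball x \<rho> \<subseteq> K \<and> diameter K \<le> \<kappa> * \<rho>)"

definition outer_normal :: "(real^'d) set \<Rightarrow> (real^'d) set \<Rightarrow> real^'d" where
  "outer_normal K F = (THE n. norm n = 1 \<and> (\<exists>c. F \<subseteq> {x. n \<bullet> x = c} \<and> K \<subseteq> {x. n \<bullet> x \<le> c}))"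

section \<open>Discrete spaces\<close>

text \<open>A polynomial on an element or on a face is represented by a polynomial on the whole space;
  the sum runs over the multi-indices of order at most \<open>k\<close>.\<close>

definition poly_le :: "nat \<Rightarrow> (real^'d \<Rightarrow> complex) \<Rightarrow> bool" where
  "poly_le k w \<longleftrightarrow> (\<exists>c. \<forall>x. w x =
     (\<Sum>\<alpha>\<in>{\<alpha> :: 'd \<Rightarrow> nat. (\<Sum>i\<in>UNIV. \<alpha> i) \<le> k}. c \<alpha> * complex_of_real (\<Prod>i\<in>UNIV. (x $ i) ^ \<alpha> i)))"

definition poly_vec_le :: "nat \<Rightarrow> (real^'d \<Rightarrow> complex^'d) \<Rightarrow> bool" where
  "poly_vec_le k v \<longleftrightarrow> (\<forall>i. poly_le k (\<lambda>x. v x $ i))"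

text \<open>A piecewise function, which is two-valued on interior faces, is a family indexed by the
  cells (elements or faces): \<open>w K\<close> is its restriction to the cell \<open>K\<close>.\<close>

type_synonym 'd cell = "(real^'d) set"
type_synonym 'd broken = "'d cell \<Rightarrow> real^'d \<Rightarrow> complex"
type_synonym 'd broken_vec = "'d cell \<Rightarrow> real^'d \<Rightarrow> complex^'d"

definition broken_poly :: "nat \<Rightarrow> 'd::finite cell set \<Rightarrow> 'd broken \<Rightarrow> bool" where
  "broken_poly k \<T> w \<longleftrightarrow> (\<forall>K\<in>\<T>. poly_le k (w K))"

definition broken_poly_vec :: "nat \<Rightarrow> 'd::finite cell set \<Rightarrow> 'd broken_vec \<Rightarrow> bool" where
  "broken_poly_vec k \<T> v \<longleftrightarrow> (\<forall>K\<in>\<T>. poly_vec_le k (v K))"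

abbreviation grad_on :: "'d::finite cell \<Rightarrow> (real^'d \<Rightarrow> complex) \<Rightarrow> real^'d \<Rightarrow> complex^'d" where
  "grad_on K w \<equiv> wgrad (interior K) w"

abbreviation div_on :: "'d::finite cell \<Rightarrow> (real^'d \<Rightarrow> complex^'d) \<Rightarrow> real^'d \<Rightarrow> complex" where
  "div_on K v \<equiv> wdiv (interior K) v"

section \<open>Helmholtz problem\<close>

text \<open>The pairing of the normal trace of a field in \<open>H(div)\<close> with the trace of a function in
  \<open>H\<^sup>1\<close>, given by Green's formula.\<close>

definition normal_trace_pairing ::
    "(real^'d) set \<Rightarrow> (real^'d \<Rightarrow> complex^'d) \<Rightarrow> (real^'d \<Rightarrow> complex) \<Rightarrow> complex" where
  "normal_trace_pairing S q v =
     ip (lebesgue_on S) (wdiv S q) v + ipv (lebesgue_on S) q (wgrad S v)"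

text \<open>The normal trace of \<open>q\<close> is only a functional, so the Robin condition is read in the dual of
  the traces on \<open>\<Gamma>R\<close> of the functions vanishing on \<open>\<Gamma>D\<close>.\<close>

definition helmholtz_solution ::
    "(real^'d) set \<Rightarrow> (real^'d) set \<Rightarrow> (real^'d) set \<Rightarrow> real \<Rightarrow> (real^'d \<Rightarrow> complex) \<Rightarrow>
     (real^'d \<Rightarrow> complex) \<Rightarrow> (real^'d \<Rightarrow> complex) \<Rightarrow> (real^'d \<Rightarrow> complex^'d) \<Rightarrow> bool" where
  "helmholtz_solution \<Omega> \<Gamma>D \<Gamma>R \<omega> f g u q \<longleftrightarrow> H1 \<Omega> u \<and> Hdiv \<Omega> q \<and>
     (AE x in lebesgue_on \<Omega>. q x + wgrad \<Omega> u x = 0) \<and>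
     (AE x in lebesgue_on \<Omega>. wdiv \<Omega> q x - complex_of_real (\<omega>\<^sup>2) * u x = f x) \<and>
     has_trace \<Omega> \<Gamma>D u (\<lambda>x. 0) \<and>
     (\<forall>v. H1 \<Omega> v \<and> has_trace \<Omega> \<Gamma>D v (\<lambda>x. 0) \<longrightarrow>
        - normal_trace_pairing \<Omega> q v
          + \<i> * complex_of_real \<omega> * ip (surface_on \<Gamma>R) (trace \<Omega> \<Gamma>R u) (trace \<Omega> \<Gamma>R v)
        = ip (surface_on \<Gamma>R) g (trace \<Omega> \<Gamma>R v))"

section \<open>HDG scheme\<close>

definition stabilization :: "'d::finite cell set \<Rightarrow> ('d cell \<Rightarrow> 'd cell \<Rightarrow> real) \<Rightarrow> bool" where
  "stabilization \<T> \<tau> \<longleftrightarrow>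
     (\<forall>K\<in>\<T>. (\<forall>F\<in>faces_of \<T> K. \<tau> K F \<ge> 0) \<and> (\<exists>F\<in>faces_of \<T> K. \<tau> K F \<noteq> 0))"

definition normal_comp :: "'d::finite cell \<Rightarrow> 'd cell \<Rightarrow> (real^'d \<Rightarrow> complex^'d) \<Rightarrow> real^'d \<Rightarrow> complex" where
  "normal_comp K F v x = (\<Sum>i\<in>UNIV. v x $ i * complex_of_real (outer_normal K F $ i))"

definition flux :: "('d::finite cell \<Rightarrow> 'd cell \<Rightarrow> real) \<Rightarrow> 'd broken_vec \<Rightarrow> 'd broken \<Rightarrow> 'd broken \<Rightarrow>
    'd cell \<Rightarrow> 'd cell \<Rightarrow> real^'d \<Rightarrow> complex" where
  "flux \<tau> qh uh uhat K F x =
     normal_comp K F (qh K) x + complex_of_real (\<tau> K F) * (uh K x - uhat F x)"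

text \<open>The unique element containing a boundary face.\<close>

definition owner :: "'d::finite cell set \<Rightarrow> 'd cell \<Rightarrow> 'd cell" where
  "owner \<T> F = (THE K. K \<in> \<T> \<and> F facet_of K)"

definition hdg_solution ::
    "'d::finite cell set \<Rightarrow> (real^'d) set \<Rightarrow> (real^'d) set \<Rightarrow> nat \<Rightarrow> real \<Rightarrow> ('d cell \<Rightarrow> 'd cell \<Rightarrow> real) \<Rightarrow>
     (real^'d \<Rightarrow> complex) \<Rightarrow> (real^'d \<Rightarrow> complex) \<Rightarrow> 'd broken_vec \<Rightarrow> 'd broken \<Rightarrow> 'd broken \<Rightarrow> bool" where
  "hdg_solution \<T> \<Gamma>D \<Gamma>R p \<omega> \<tau> f g qh uh uhat \<longleftrightarrow>
     broken_poly_vec p \<T> qh \<and> broken_poly p \<T> uh \<and> broken_poly p (faces \<T>) uhat \<and>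
     (\<forall>vh. broken_poly_vec p \<T> vh \<longrightarrow>
        (\<Sum>K\<in>\<T>. ipv (lebesgue_on K) (qh K) (vh K))
        - (\<Sum>K\<in>\<T>. ip (lebesgue_on K) (uh K) (div_on K (vh K)))
        + (\<Sum>K\<in>\<T>. \<Sum>F\<in>faces_of \<T> K. ip (surface_on F) (uhat F) (normal_comp K F (vh K))) = 0) \<and>
     (\<forall>wh. broken_poly p \<T> wh \<longrightarrow>
        - complex_of_real (\<omega>\<^sup>2) * (\<Sum>K\<in>\<T>. ip (lebesgue_on K) (uh K) (wh K))
        - (\<Sum>K\<in>\<T>. ipv (lebesgue_on K) (qh K) (grad_on K (wh K)))
        + (\<Sum>K\<in>\<T>. \<Sum>F\<in>faces_of \<T> K. ip (surface_on F) (flux \<tau> qh uh uhat K F) (wh K))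
        = (\<Sum>K\<in>\<T>. ip (lebesgue_on K) f (wh K))) \<and>
     (\<forall>\<mu>. broken_poly p (faces \<T>) \<mu> \<longrightarrow>
        (\<Sum>K\<in>\<T>. \<Sum>F\<in>faces_of \<T> K \<inter> interior_faces \<T>.
           ip (surface_on F) (flux \<tau> qh uh uhat K F) (\<mu> F)) = 0 \<and>
        (\<Sum>F\<in>faces_on \<Gamma>R \<T>. ip (surface_on F)
           (\<lambda>x. - flux \<tau> qh uh uhat (owner \<T> F) F x + \<i> * complex_of_real \<omega> * uhat F x) (\<mu> F))
          = (\<Sum>F\<in>faces_on \<Gamma>R \<T>. ip (surface_on F) g (\<mu> F)) \<and>
        (\<Sum>F\<in>faces_on \<Gamma>D \<T>. ip (surface_on F) (uhat F) (\<mu> F)) = 0)"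

section \<open>Local problems, indicator and error\<close>

text \<open>In the following, \<open>s\<close> is the sign, \<open>1\<close> or \<open>-1\<close>.\<close>

definition ip1 :: "real \<Rightarrow> 'd::finite cell \<Rightarrow> (real^'d \<Rightarrow> complex) \<Rightarrow> (real^'d \<Rightarrow> complex) \<Rightarrow> complex" where
  "ip1 \<omega> K w v = complex_of_real (\<omega>\<^sup>2) * ip (lebesgue_on K) w v
     + ipv (lebesgue_on K) (grad_on K w) (grad_on K v)"

definition norm1 :: "real \<Rightarrow> 'd::finite cell \<Rightarrow> (real^'d \<Rightarrow> complex) \<Rightarrow> real" where
  "norm1 \<omega> K w = sqrt (\<omega>\<^sup>2 * (l2norm (lebesgue_on K) w)\<^sup>2 + (l2norm (lebesgue_on K) (grad_on K w))\<^sup>2)"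

definition bform ::
    "real \<Rightarrow> real \<Rightarrow> 'd::finite cell \<Rightarrow> (real^'d \<Rightarrow> complex) \<Rightarrow> (real^'d \<Rightarrow> complex) \<Rightarrow> complex" where
  "bform s \<omega> K w v = ipv (lebesgue_on K) (grad_on K w) (grad_on K v)
     + complex_of_real s * complex_of_real (\<omega>\<^sup>2) * ip (lebesgue_on K) w v"

definition gform :: "real \<Rightarrow> real \<Rightarrow> 'd::finite broken_vec \<Rightarrow> 'd broken \<Rightarrow> 'd cell \<Rightarrow>
    (real^'d \<Rightarrow> complex) \<Rightarrow> complex" where
  "gform s \<omega> qh uh K v = - ipv (lebesgue_on K) (qh K) (grad_on K v)
     + complex_of_real s * complex_of_real (\<omega>\<^sup>2) * ip (lebesgue_on K) (uh K) v"

definition local_saddle_point :: "real \<Rightarrow> nat \<Rightarrow> real \<Rightarrow> 'd::finite broken_vec \<Rightarrow> 'd broken \<Rightarrow>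
    'd cell \<Rightarrow> (real^'d \<Rightarrow> complex) \<Rightarrow> (real^'d \<Rightarrow> complex) \<Rightarrow> bool" where
  "local_saddle_point s p \<omega> qh uh K r \<nu> \<longleftrightarrow>
     (\<forall>v. poly_le (p + 2) v \<longrightarrow> ip1 \<omega> K r v + bform s \<omega> K \<nu> v = gform s \<omega> qh uh K v) \<and>
     (\<forall>w. poly_le (p + 1) w \<longrightarrow> bform s \<omega> K w r = 0)"

text \<open>A choice \<open>nrm\<close> of a unit normal for each interior face orients the jumps.\<close>

definition face_normals :: "'d::finite cell set \<Rightarrow> ('d cell \<Rightarrow> real^'d) \<Rightarrow> bool" where
  "face_normals \<T> nrm \<longleftrightarrow>
     (\<forall>F\<in>interior_faces \<T>. \<exists>K\<in>\<T>. F facet_of K \<and> nrm F = outer_normal K F)"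

definition plus_elem :: "'d::finite cell set \<Rightarrow> ('d cell \<Rightarrow> real^'d) \<Rightarrow> 'd cell \<Rightarrow> 'd cell" where
  "plus_elem \<T> nrm F = (THE K. K \<in> \<T> \<and> F facet_of K \<and> outer_normal K F = nrm F)"

definition minus_elem :: "'d::finite cell set \<Rightarrow> ('d cell \<Rightarrow> real^'d) \<Rightarrow> 'd cell \<Rightarrow> 'd cell" where
  "minus_elem \<T> nrm F = (THE K. K \<in> \<T> \<and> F facet_of K \<and> outer_normal K F = - nrm F)"

definition elem_trace :: "'d::finite broken \<Rightarrow> 'd cell \<Rightarrow> 'd cell \<Rightarrow> real^'d \<Rightarrow> complex" where
  "elem_trace w K F = trace (interior K) F (w K)"

definition jump :: "'d::finite cell set \<Rightarrow> ('d cell \<Rightarrow> real^'d) \<Rightarrow> 'd broken \<Rightarrow> 'd cell \<Rightarrow>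
    real^'d \<Rightarrow> complex" where
  "jump \<T> nrm w F x =
     (if F \<in> interior_faces \<T>
      then elem_trace w (plus_elem \<T> nrm F) F x - elem_trace w (minus_elem \<T> nrm F) F x
      else elem_trace w (owner \<T> F) F x)"

definition jump_seminorm :: "'d::finite cell set \<Rightarrow> (real^'d) set \<Rightarrow> (real^'d) set \<Rightarrow>
    ('d cell \<Rightarrow> real^'d) \<Rightarrow> real \<Rightarrow> 'd cell \<Rightarrow> 'd broken \<Rightarrow> real" where
  "jump_seminorm \<T> \<Gamma>D \<Gamma>R nrm \<omega> K w = sqrt (
     (\<Sum>F\<in>faces_of \<T> K \<inter> (interior_faces \<T> \<union> faces_on \<Gamma>D \<T>).
        inverse (diameter F) * (l2norm (surface_on F) (jump \<T> nrm w F))\<^sup>2)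
     + (\<Sum>F\<in>faces_of \<T> K \<inter> faces_on \<Gamma>R \<T>.
        \<omega>\<^sup>2 * diameter F * (l2norm (surface_on F) (elem_trace w K F))\<^sup>2))"

definition norm1J :: "'d::finite cell set \<Rightarrow> (real^'d) set \<Rightarrow> (real^'d) set \<Rightarrow>
    ('d cell \<Rightarrow> real^'d) \<Rightarrow> real \<Rightarrow> 'd cell \<Rightarrow> 'd broken \<Rightarrow> real" where
  "norm1J \<T> \<Gamma>D \<Gamma>R nrm \<omega> K w =
     sqrt ((norm1 \<omega> K (w K))\<^sup>2 + (jump_seminorm \<T> \<Gamma>D \<Gamma>R nrm \<omega> K w)\<^sup>2)"

definition indicator_eta :: "real \<Rightarrow> 'd::finite broken_vec \<Rightarrow> 'd broken \<Rightarrow> 'd broken \<Rightarrow> 'd broken \<Rightarrow>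
    'd cell \<Rightarrow> real" where
  "indicator_eta \<omega> qh uh r \<nu> K = sqrt (
     (norm1 \<omega> K (r K))\<^sup>2
     + (l2norm (lebesgue_on K) (\<lambda>x. qh K x + grad_on K (\<nu> K) x))\<^sup>2
     + \<omega>\<^sup>2 * (l2norm (lebesgue_on K) (\<lambda>x. uh K x - \<nu> K x))\<^sup>2)"

definition error_e :: "'d::finite cell set \<Rightarrow> (real^'d) set \<Rightarrow> (real^'d) set \<Rightarrow>
    ('d cell \<Rightarrow> real^'d) \<Rightarrow> real \<Rightarrow> (real^'d \<Rightarrow> complex) \<Rightarrow> (real^'d \<Rightarrow> complex^'d) \<Rightarrow>
    'd broken_vec \<Rightarrow> 'd broken \<Rightarrow> 'd broken \<Rightarrow> 'd cell \<Rightarrow> real" where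
  "error_e \<T> \<Gamma>D \<Gamma>R nrm \<omega> u q qh uh \<nu> K = sqrt (
     (norm1J \<T> \<Gamma>D \<Gamma>R nrm \<omega> K (\<lambda>K' x. u x - \<nu> K' x))\<^sup>2
     + \<omega>\<^sup>2 * (l2norm (lebesgue_on K) (\<lambda>x. u x - uh K x))\<^sup>2
     + (l2norm (lebesgue_on K) (\<lambda>x. q x - qh K x))\<^sup>2)"

end

theory Submission
  imports Defs "HOL-Computational_Algebra.Polynomial"
begin

text \<open>
  The idea is short. The first local equation can be written as
  \<open>(r, v)\<^sub>1 = -(q\<^sub>h + \<nabla>\<nu>, \<nabla>v) + s \<omega>\<^sup>2 (u\<^sub>h - \<nu>, v)\<close>. The residual \<open>r\<close> has the degree of
  the test functions, so \<open>v = r\<close> is allowed, and Young's inequality bounds \<open>\<parallel>r\<parallel>\<^sub>1\<^sup>2\<close> by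
  \<open>\<parallel>q\<^sub>h + \<nabla>\<nu>\<parallel>\<^sup>2 + \<omega>\<^sup>2 \<parallel>u\<^sub>h - \<nu>\<parallel>\<^sup>2\<close> (\<open>saddle_point_residual_le\<close>). Hence the squared indicator
  is at most twice the latter sum. As \<open>q = -\<nabla>u\<close>, both discrepancies are differences of two
  terms of the error, which costs another factor \<open>2\<close> (\<open>local_efficiency\<close>). The indicator is
  therefore at most twice the error, and \<open>2 \<le> \<surd>6\<close>.

  What needs work is the meaning of the gradients. They are arbitrarily chosen
  representatives of weak gradients, so the argument depends on three facts: a weak gradient on an
  open set is unique almost everywhere (\<open>weak_grad_unique\<close>), the classical gradient of a polynomial
  is a weak gradient (\<open>has_weak_grad_Ck_1\<close>), and the weak gradient of \<open>u\<close> on the domain is one on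
  each element (\<open>has_weak_grad_subset\<close>). Uniqueness is the fundamental lemma of the calculus of
  variations, proved by approximating indicators of boxes by smooth bumps; the second fact
  is integration by parts, derived from the translation invariance of Lebesgue measure. The third
  one needs that the interior of an element lies in the domain, which holds because a Lipschitz
  domain is the interior of its closure (\<open>interior_closure_lipschitz_domain\<close>).
\<close>

section \<open>Differentiable functions\<close>

lemma Ck_const: "Ck k (\<lambda>x::real^'d. c::'b::real_normed_vector)"
  by (induction k arbitrary: c) (simp_all add: frechet_derivative_const)

lemma Ck_mono_Suc: "Ck (Suc k) \<phi> \<Longrightarrow> Ck k \<phi>"
proof (induction k arbitrary: \<phi>)
  case 0
  then show ?case
    by (auto simp: continuous_on_eq_continuous_at intro: differentiable_imp_continuous_within)
next
  case (Suc k)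
  then show ?case by (metis Ck.simps(2))
qed

lemma Ck_continuous: "Ck k \<phi> \<Longrightarrow> continuous_on UNIV \<phi>"
proof (induction k)
  case (Suc k)
  then show ?case using Ck_mono_Suc by blast
qed simp

lemma Ck_add:
  fixes \<phi> \<psi> :: "real^'d \<Rightarrow> 'b::real_normed_vector"
  shows "Ck k \<phi> \<Longrightarrow> Ck k \<psi> \<Longrightarrow> Ck k (\<lambda>x. \<phi> x + \<psi> x)"
proof (induction k arbitrary: \<phi> \<psi>)
  case 0
  then show ?case by (simp add: continuous_on_add)
next
  case (Suc k)
  have "frechet_derivative (\<lambda>x. \<phi> x + \<psi> x) (at x) =
     (\<lambda>h. frechet_derivative \<phi> (at x) h + frechet_derivative \<psi> (at x) h)" for x
    using Suc.prems by (intro frechet_derivative_at[symmetric] has_derivative_add) 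
      (auto simp: frechet_derivative_works)
  then show ?case using Suc by (auto intro: differentiable_add)
qed

lemma Ck_mult:
  fixes \<phi> \<psi> :: "real^'d \<Rightarrow> 'b::real_normed_algebra"
  shows "Ck k \<phi> \<Longrightarrow> Ck k \<psi> \<Longrightarrow> Ck k (\<lambda>x. \<phi> x * \<psi> x)"
proof (induction k arbitrary: \<phi> \<psi>)
  case 0
  then show ?case by (simp add: continuous_on_mult)
next
  case (Suc k)
  have "frechet_derivative (\<lambda>x. \<phi> x * \<psi> x) (at x) =
     (\<lambda>h. \<phi> x * frechet_derivative \<psi> (at x) h + frechet_derivative \<phi> (at x) h * \<psi> x)" for x
    using Suc.prems by (intro frechet_derivative_at[symmetric] has_derivative_mult) 
      (auto simp: frechet_derivative_works)
  moreover have "Ck k \<phi>" "Ck k \<psi>"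
    using Suc.prems Ck_mono_Suc by blast+
  ultimately show ?case using Suc by (auto intro!: Ck_add differentiable_mult)
qed

lemma Ck_sum:
  fixes \<phi> :: "'i \<Rightarrow> real^'d \<Rightarrow> 'b::real_normed_vector"
  assumes "\<And>i. i \<in> I \<Longrightarrow> Ck k (\<phi> i)"
  shows "Ck k (\<lambda>x. \<Sum>i\<in>I. \<phi> i x)"
  using assms by (induction I rule: infinite_finite_induct) (auto simp: Ck_const intro: Ck_add)

lemma Ck_prod:
  fixes \<phi> :: "'i \<Rightarrow> real^'d \<Rightarrow> 'b::real_normed_field"
  assumes "\<And>i. i \<in> I \<Longrightarrow> Ck k (\<phi> i)"
  shows "Ck k (\<lambda>x. \<Prod>i\<in>I. \<phi> i x)"
  using assms by (induction I rule: infinite_finite_induct) (auto simp: Ck_const intro: Ck_mult)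

lemma Ck_power:
  fixes \<phi> :: "real^'d \<Rightarrow> 'b::real_normed_field"
  shows "Ck k \<phi> \<Longrightarrow> Ck k (\<lambda>x. \<phi> x ^ n)"
  by (induction n) (auto simp: Ck_const intro: Ck_mult)

lemma Ck_linear:
  fixes L :: "real^'d \<Rightarrow> 'b::real_normed_vector"
  assumes "bounded_linear L"
  shows "Ck k L"
proof (cases k)
  case 0
  then show ?thesis using assms by (simp add: linear_continuous_on)
next
  case (Suc j)
  have "(L has_derivative L) (at x)" for x
    using assms by (rule bounded_linear_imp_has_derivative)
  then have "frechet_derivative L (at x) = L" for x
    using frechet_derivative_at by metis
  with assms Suc show ?thesis by (auto simp: Ck_const intro: bounded_linear_imp_differentiable)
qed

lemma Ck_poly_le:
  fixes w :: "real^'d \<Rightarrow> complex"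
  assumes "poly_le m w"
  shows "Ck k w"
proof -
  obtain c where c: "\<And>x. w x = (\<Sum>\<alpha>\<in>{\<alpha> :: 'd \<Rightarrow> nat. (\<Sum>i\<in>UNIV. \<alpha> i) \<le> m}.
      c \<alpha> * complex_of_real (\<Prod>i\<in>UNIV. (x $ i) ^ \<alpha> i))"
    using assms unfolding poly_le_def by blast
  have "Ck k (\<lambda>x::real^'d. complex_of_real (x $ i))" for i
    by (intro Ck_linear bounded_linear_compose[OF bounded_linear_of_real] bounded_linear_vec_nth)
  then show ?thesis
    unfolding c of_real_prod of_real_power ext[of w, OF c]
    by (intro Ck_sum Ck_mult Ck_const Ck_prod Ck_power)
qed

section \<open>Smooth bump functions\<close>

text \<open>The building block of smooth functions with compact support: \<open>flat 1\<close> is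
  \<open>exp (-1/t)\<close>, extended by zero to \<open>t \<le> 0\<close>. The polynomial factor in \<open>1/t\<close> makes
  the family closed under differentiation, so that all derivatives are handled by one induction.\<close>

definition flat :: "real poly \<Rightarrow> real \<Rightarrow> real" where
  "flat P t = (if t > 0 then poly P (inverse t) * exp (- inverse t) else 0)"

lemma poly_exp_decay: "((\<lambda>x. poly P x * exp (- x)) \<longlongrightarrow> (0::real)) at_top"
proof -
  have "((\<lambda>x. \<Sum>i\<le>degree P. coeff P i * (x ^ i / exp x)) \<longlongrightarrow> (\<Sum>i\<le>degree P. coeff P i * 0)) at_top"
    by (intro tendsto_intros tendsto_power_div_exp_0)
  then show ?thesis
    by (simp add: poly_altdef sum_distrib_right exp_minus field_simps sum_divide_distrib)
qed

text \<open>For \<open>t > 0\<close> this is the product rule with \<open>d(1/t)/dt = -(1/t)\<^sup>2\<close>, whence the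
  factor \<open>[:0, 0, 1:]\<close>. At \<open>0\<close> the right difference quotient is a polynomial in \<open>1/t\<close>
  times \<open>exp (-1/t)\<close> and tends to zero, because the exponential beats every polynomial.\<close>

lemma flat_has_derivative:
  "(flat P has_real_derivative flat ([:0, 0, 1:] * (P - pderiv P)) t) (at t)"
proof -
  consider "t > 0" | "t < 0" | "t = 0" by linarith
  then show ?thesis
  proof cases
    case 1
    have "((\<lambda>t. poly P (inverse t) * exp (- inverse t)) has_real_derivative
        flat ([:0, 0, 1:] * (P - pderiv P)) t) (at t)"
      using 1 by (auto intro!: derivative_eq_intros DERIV_chain'[OF _ poly_DERIV]
          simp: flat_def field_simps power2_eq_square)
    then show ?thesis
      by (rule DERIV_cong_ev[THEN iffD1, OF refl _ refl, rotated])
         (use 1 in \<open>auto simp: flat_def intro: eventually_mono[OF eventually_gt_at_top] 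
           intro!: eventually_mono[OF eventually_nhds_in_open[of "{0<..}"]]\<close>)
  next
    case 2
    have "((\<lambda>t. 0) has_real_derivative flat ([:0, 0, 1:] * (P - pderiv P)) t) (at t)"
      using 2 by (auto simp: flat_def)
    then show ?thesis
      by (rule DERIV_cong_ev[THEN iffD1, OF refl _ refl, rotated])
         (use 2 in \<open>auto simp: flat_def
           intro!: eventually_mono[OF eventually_nhds_in_open[of "{..<0}"]]\<close>)
  next
    case 3
    have "((\<lambda>h. flat P h / h) \<longlongrightarrow> 0) (at_right 0)"
    proof -
      have "((\<lambda>h. poly ([:0,1:] * P) (inverse h) * exp (- inverse h)) \<longlongrightarrow> (0::real)) (at_right 0)"
        by (rule filterlim_compose[OF poly_exp_decay filterlim_inverse_at_top_right])
      then show ?thesis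
        by (rule Lim_transform_eventually)
           (auto simp: eventually_at_filter flat_def field_simps)
    qed
    moreover have "((\<lambda>h. flat P h / h) \<longlongrightarrow> 0) (at_left 0)"
      by (rule tendsto_eventually) (auto simp: eventually_at_filter flat_def)
    ultimately have "((\<lambda>h. flat P h / h) \<longlongrightarrow> 0) (at 0)"
      by (simp add: filterlim_split_at)
    with 3 show ?thesis by (simp add: DERIV_def flat_def)
  qed
qed

lemma Ck_flat_coordinate:
  fixes i :: "'d::finite" and a b :: real
  shows "Ck k (\<lambda>x::real^'d. flat P (a * x $ i + b))"
proof (induction k arbitrary: P)
  have D: "((\<lambda>x::real^'d. flat P (a * x $ i + b)) has_derivative
      (\<lambda>h. flat ([:0, 0, 1:] * (P - pderiv P)) (a * x $ i + b) * (a * h $ i))) (at x)" for P x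
  proof -
    have "((\<lambda>x::real^'d. a * x $ i + b) has_derivative (\<lambda>h. a * h $ i)) (at x)"
      by (auto intro!: derivative_eq_intros bounded_linear_imp_has_derivative)
    from has_derivative_compose[OF this flat_has_derivative[unfolded has_field_derivative_def]]
    show ?thesis .
  qed
  {
    case 0
    show ?case
      using D[THEN has_derivative_continuous] by (simp add: continuous_on_eq_continuous_at)
  next
    case (Suc k)
    show ?case
      unfolding Ck.simps frechet_derivative_at[OF D, symmetric]
      using D by (auto intro!: Ck_mult Ck_const Suc simp: differentiable_def)
  }
qed

text \<open>As \<open>n\<close> grows, the factors rise to \<open>1\<close> at every interior point of the box, so these
  smooth functions tend pointwise to the indicator of the open box while remaining between
  \<open>0\<close> and \<open>1\<close>.\<close>

definition box_bump :: "nat \<Rightarrow> real^'d \<Rightarrow> real^'d \<Rightarrow> real^'d \<Rightarrow> real" where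
  "box_bump n a b x =
     (\<Prod>i\<in>UNIV. flat 1 (real n * (x $ i - a $ i)) * flat 1 (real n * (b $ i - x $ i)))"

lemma flat_1_bounds: "0 \<le> flat 1 t" "flat 1 t \<le> 1"
  by (auto simp: flat_def)

lemma flat_1_tendsto:
  assumes "t > 0"
  shows "(\<lambda>n. flat 1 (real n * t)) \<longlonglongrightarrow> 1"
proof -
  have "(\<lambda>n. exp (- (inverse t * inverse (real n)))) \<longlonglongrightarrow> exp (- (inverse t * 0))"
    by (intro tendsto_intros lim_inverse_n)
  moreover have "\<forall>\<^sub>F n in sequentially. exp (- (inverse t * inverse (real n))) = flat 1 (real n * t)"
    using eventually_gt_at_top[of 0] by eventually_elim (use assms in \<open>auto simp: flat_def field_simps\<close>)
  ultimately show ?thesis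
    using Lim_transform_eventually by fastforce
qed

lemma Cinf_box_bump: "Cinf (box_bump n a b)"
proof -
  have "Ck k (\<lambda>x. flat 1 (real n * (x $ i - a $ i)))"
       "Ck k (\<lambda>x. flat 1 (real n * (b $ i - x $ i)))" for k i
    using Ck_flat_coordinate[of k 1 "real n" i "- real n * a $ i"]
          Ck_flat_coordinate[of k 1 "- real n" i "real n * b $ i"]
    by (simp_all add: algebra_simps)
  then show ?thesis
    unfolding Cinf_def box_bump_def[abs_def] by (auto intro!: Ck_prod Ck_mult)
qed

lemma box_bump_bounds: "0 \<le> box_bump n a b x" "box_bump n a b x \<le> 1"
proof -
  have "0 \<le> flat 1 s * flat 1 t" "flat 1 s * flat 1 t \<le> 1" for s t
    by (simp_all add: flat_1_bounds mult_le_one)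
  then show "0 \<le> box_bump n a b x" "box_bump n a b x \<le> 1"
    unfolding box_bump_def by (simp_all add: prod_nonneg prod_le_1)
qed

lemma box_bump_outside:
  assumes "x \<notin> box a b"
  shows "box_bump n a b x = 0"
proof -
  obtain i where "x $ i \<le> a $ i \<or> b $ i \<le> x $ i"
    using assms by (auto simp: mem_box_cart not_less)
  then have "flat 1 (real n * (x $ i - a $ i)) * flat 1 (real n * (b $ i - x $ i)) = 0"
    by (auto simp: flat_def mult_le_0_iff zero_less_mult_iff)
  then show ?thesis
    unfolding box_bump_def by (intro prod_zero bexI[of _ i]) simp_all
qed

lemma box_bump_tendsto: "(\<lambda>n. box_bump n a b x) \<longlonglongrightarrow> indicator (box a b) x"
proof (cases "x \<in> box a b")
  case True
  then have "(\<lambda>n. box_bump n a b x) \<longlonglongrightarrow> (\<Prod>i\<in>(UNIV :: 'a set). 1 * 1)"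
    unfolding box_bump_def by (intro tendsto_intros flat_1_tendsto) (auto simp: mem_box_cart)
  with True show ?thesis by simp
qed (simp add: box_bump_outside)

lemma test_function_box_bump:
  assumes "cbox a b \<subseteq> S"
  shows "test_function S (box_bump n a b)"
proof -
  have "{x. box_bump n a b x \<noteq> 0} \<subseteq> cbox a b"
    using box_bump_outside box_subset_cbox by blast
  then have sub: "closure {x. box_bump n a b x \<noteq> 0} \<subseteq> cbox a b"
    by (simp add: closure_minimal closed_cbox)
  then have "compact (closure {x. box_bump n a b x \<noteq> 0})"
    by (metis bounded_subset bounded_cbox closed_closure compact_eq_bounded_closed)
  with sub assms show ?thesis by (auto simp: test_function_def Cinf_box_bump)
qed

section \<open>Fundamental lemma of the calculus of variations\<close>

text \<open>The bumps are admissible test functions; dominated convergence, with the restriction of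
  \<open>norm f\<close> to the closed box as majorant, passes from them to the indicator of the box.\<close>

lemma integral_box_eq_0:
  fixes f :: "real^'d \<Rightarrow> 'b::euclidean_space"
  assumes S: "open S" and ab: "cbox a b \<subseteq> S" and f: "locally_integrable S f"
    and z: "\<And>\<phi>. test_function S \<phi> \<Longrightarrow> (\<integral>x. \<phi> x *\<^sub>R f x \<partial>lebesgue_on S) = 0"
  shows "(LINT x:box a b|lebesgue. f x) = 0"
proof -
  let ?g = "\<lambda>x. indicat_real (cbox a b) x *\<^sub>R f x"
  have g: "integrable lebesgue ?g"
    using f ab compact_cbox[of a b] by (simp add: locally_integrable_def set_integrable_def)
  have meas: "box_bump n a b \<in> borel_measurable lebesgue" for n
    using Cinf_box_bump[of n a b, unfolded Cinf_def, rule_format, of 0]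
    by (auto intro!: measurable_completion borel_measurable_continuous_onI)
  have meas_g: "?g \<in> borel_measurable lebesgue"
    using g by (rule borel_measurable_integrable)
  have "(\<integral>x. box_bump n a b x *\<^sub>R ?g x \<partial>lebesgue) = 0" for n
  proof -
    have "(\<lambda>x. indicator S x *\<^sub>R (box_bump n a b x *\<^sub>R f x)) = (\<lambda>x. box_bump n a b x *\<^sub>R ?g x)"
    proof
      fix x
      show "indicator S x *\<^sub>R (box_bump n a b x *\<^sub>R f x) = box_bump n a b x *\<^sub>R ?g x"
        using ab box_subset_cbox[of a b] box_bump_outside[of x a b n]
        by (cases "x \<in> box a b") (auto simp: indicator_def)
    qed
    moreover have "(\<integral>x. indicator S x *\<^sub>R (box_bump n a b x *\<^sub>R f x) \<partial>lebesgue) = 0"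
      using z[OF test_function_box_bump[OF ab, of n]] S by (subst (asm) integral_restrict_space) auto
    ultimately show ?thesis by simp
  qed
  moreover have "(\<lambda>n. \<integral>x. box_bump n a b x *\<^sub>R ?g x \<partial>lebesgue)
      \<longlonglongrightarrow> (\<integral>x. indicator (box a b) x *\<^sub>R ?g x \<partial>lebesgue)"
  proof (rule integral_dominated_convergence[where w = "\<lambda>x. norm (?g x)"])
    show "AE x in lebesgue. norm (box_bump n a b x *\<^sub>R ?g x) \<le> norm (?g x)" for n
    proof (rule AE_I2)
      fix x
      show "norm (box_bump n a b x *\<^sub>R ?g x) \<le> norm (?g x)"
        using mult_right_mono[OF box_bump_bounds(2)[of n a b x] norm_ge_zero[of "?g x"]]
        by (simp only: norm_scaleR abs_of_nonneg[OF box_bump_bounds(1)] mult_1)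
    qed
    show "AE x in lebesgue. (\<lambda>n. box_bump n a b x *\<^sub>R ?g x) \<longlonglongrightarrow> indicator (box a b) x *\<^sub>R ?g x"
      by (auto intro!: tendsto_intros box_bump_tendsto)
    show "integrable lebesgue (\<lambda>x. norm (?g x))"
      using g by (rule integrable_norm)
    show "(\<lambda>x. indicator (box a b) x *\<^sub>R ?g x) \<in> borel_measurable lebesgue"
      by (rule borel_measurable_scaleR[OF borel_measurable_indicator meas_g]) simp
    show "(\<lambda>x. box_bump n a b x *\<^sub>R ?g x) \<in> borel_measurable lebesgue" for n
      using meas meas_g by (rule borel_measurable_scaleR)
  qed
  ultimately have "(\<integral>x. indicator (box a b) x *\<^sub>R ?g x \<partial>lebesgue) = 0"
    by (simp only: LIMSEQ_const_iff)
  moreover have "(\<lambda>x. indicator (box a b) x *\<^sub>R ?g x) = (\<lambda>x. indicator (box a b) x *\<^sub>R f x)"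
    using box_subset_cbox[of a b] by (auto simp: indicator_def fun_eq_iff)
  ultimately show ?thesis by (simp add: set_lebesgue_integral_def)
qed

lemma sigma_finite_lebesgue: "sigma_finite_measure (lebesgue :: 'a::euclidean_space measure)"
proof
  obtain A :: "'a set set" where "countable A" "A \<subseteq> sets lborel" "\<Union>A = space lborel"
      "\<forall>a\<in>A. emeasure lborel a \<noteq> \<infinity>"
    using lborel.sigma_finite_countable by blast
  then show "\<exists>A::'a set set. countable A \<and> A \<subseteq> sets lebesgue \<and> \<Union>A = space lebesgue \<and>
      (\<forall>a\<in>A. emeasure lebesgue a \<noteq> \<infinity>)"
    by (intro exI[of _ A]) (auto simp: subset_eq)
qed

text \<open>Open boxes form a generator of the Borel sets that is stable under intersection, so by
  Dynkin's argument the integral over every Borel set, hence over every Lebesgue set, vanishes.\<close>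

lemma AE_zero_if_box_integrals_zero:
  fixes F :: "'a::euclidean_space \<Rightarrow> 'b::euclidean_space"
  assumes F: "integrable lebesgue F" and total: "integral\<^sup>L lebesgue F = 0"
    and box: "\<And>a b. (LINT x:box a b|lebesgue. F x) = 0"
  shows "AE x in lebesgue. F x = 0"
proof -
  interpret sigma_finite_measure "lebesgue :: 'a measure" by (rule sigma_finite_lebesgue)
  have int: "set_integrable lebesgue A F" if "A \<in> sets lebesgue" for A
    using F that by (simp add: set_integrable_def integrable_mult_indicator)
  have borel: "(LINT x:A|lebesgue. F x) = 0" if A: "A \<in> sets borel" for A
  proof -
    have "Int_stable (range (\<lambda>(a, b). box a b :: 'a set))"
      by (auto simp: Int_stable_def box_Int_box)
    moreover have "(range (\<lambda>(a, b). box a b)) \<subseteq> Pow (UNIV :: 'a set)"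
      by auto
    moreover have "A \<in> sigma_sets UNIV (range (\<lambda>(a, b). box a b))"
      using A unfolding borel_eq_box by simp
    ultimately show ?thesis
    proof (induction rule: sigma_sets_induct_disjoint)
      case (basic A)
      then show ?case using box by auto
    next
      case empty
      then show ?case by (simp add: set_lebesgue_integral_def)
    next
      case (compl A)
      then have A: "A \<in> sets lebesgue" by (simp add: borel_eq_box)
      have "(LINT x:(UNIV - A) \<union> A|lebesgue. F x) = (LINT x:UNIV - A|lebesgue. F x) + (LINT x:A|lebesgue. F x)"
        using A by (intro set_integral_Un int) auto
      with compl total show ?case by (simp add: set_lebesgue_integral_def)
    next
      case (union A)
      then have A: "A i \<in> sets lebesgue" for i by (simp add: borel_eq_box subset_eq)
      have "(LINT x:(\<Union>i. A i)|lebesgue. F x) = (\<Sum>i. LINT x:A i|lebesgue. F x)"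
        using A union.hyps(1)
        by (intro lebesgue_integral_countable_add int) (auto simp: disjoint_family_on_def)
      with union show ?case by simp
    qed
  qed
  show ?thesis
  proof (rule density_zero[OF F])
    fix A :: "'a set"
    assume A: "A \<in> sets lebesgue"
    then obtain B N N' where N: "A = B \<union> N" "N \<subseteq> N'" "N' \<in> null_sets lborel" "B \<in> sets lborel"
      by (rule sets_completionE)
    then have "AE x in lebesgue. x \<notin> N'"
      by (intro AE_not_in null_sets_completionI)
    then have "AE x in lebesgue. x \<in> A \<longleftrightarrow> x \<in> B"
      by eventually_elim (use N in auto)
    then have "(LINT x:B|lebesgue. F x) = (LINT x:A|lebesgue. F x)"
      using A N int[of A] int[of B] 
      by (intro set_integral_cong_set)
         (auto simp: set_borel_measurable_def set_integrable_def dest: borel_measurable_integrable)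
    with borel[of B] N show "(LINT x:A|lebesgue. F x) = 0" by simp
  qed
qed

text \<open>The open set \<open>S\<close> is a countable union of closed boxes, and on each of them \<open>f\<close> is
  integrable with vanishing integral over all open subboxes.\<close>

lemma fundamental_lemma_calculus_of_variations:
  fixes f :: "real^'d \<Rightarrow> 'b::euclidean_space"
  assumes S: "open S" and f: "locally_integrable S f"
    and z: "\<And>\<phi>. test_function S \<phi> \<Longrightarrow> (\<integral>x. \<phi> x *\<^sub>R f x \<partial>lebesgue_on S) = 0"
  shows "AE x in lebesgue_on S. f x = 0"
proof -
  obtain \<D> where D: "countable \<D>" "\<D> \<subseteq> Pow S" "\<And>X. X \<in> \<D> \<Longrightarrow> \<exists>a b. X = cbox a b" "\<Union>\<D> = S"
    using open_countable_Union_open_cbox[OF S] by metis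
  have "AE x in lebesgue. x \<in> X \<longrightarrow> f x = 0" if XD: "X \<in> \<D>" for X
  proof -
    obtain c d where X: "X = cbox c d" using D(3) XD by blast
    then have cd: "cbox c d \<subseteq> S" using D(2) XD by blast
    have sub: "(LINT x:box a b|lebesgue. f x) = 0" if "box a b \<subseteq> box c d" for a b
    proof (cases "box a b = {}")
      case False
      then have "cbox a b = closure (box a b)" by (rule closure_box[symmetric])
      also have "\<dots> \<subseteq> closure (box c d)" by (rule closure_mono[OF that])
      also have "\<dots> \<subseteq> cbox c d" by (intro closure_minimal box_subset_cbox closed_cbox)
      finally have "cbox a b \<subseteq> cbox c d" .
      from this cd have "cbox a b \<subseteq> S" by (rule order_trans)
      from S this f z show ?thesis by (rule integral_box_eq_0)
    qed (simp add: set_lebesgue_integral_def)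
    have "AE x in lebesgue. indicat_real (box c d) x *\<^sub>R f x = 0"
    proof (rule AE_zero_if_box_integrals_zero)
      have "set_integrable lebesgue (cbox c d) f"
        using f cd compact_cbox[of c d] by (simp add: locally_integrable_def)
      then have "set_integrable lebesgue (box c d) f"
        by (rule set_integrable_subset) (auto simp: box_subset_cbox)
      then show "integrable lebesgue (\<lambda>x. indicat_real (box c d) x *\<^sub>R f x)"
        by (simp add: set_integrable_def)
      show "integral\<^sup>L lebesgue (\<lambda>x. indicat_real (box c d) x *\<^sub>R f x) = 0"
        using sub[of c d] by (simp add: set_lebesgue_integral_def)
      show "(LINT x:box a b|lebesgue. indicat_real (box c d) x *\<^sub>R f x) = 0" for a b
      proof -
        have "(LINT x:box a b|lebesgue. indicat_real (box c d) x *\<^sub>R f x) = (LINT x:box a b \<inter> box c d|lebesgue. f x)"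
          by (simp add: set_lebesgue_integral_def indicator_inter_arith)
        moreover
        have "\<exists>a' b'. box a b \<inter> box c d = box a' b'"
          unfolding box_Int_box by (intro exI) (rule refl)
        then obtain a' b' where "box a b \<inter> box c d = box a' b'" by (elim exE)
        ultimately show ?thesis using sub[of a' b'] by (metis Int_lower2)
      qed
    qed
    moreover have "AE x in lebesgue. x \<notin> cbox c d - box c d"
      by (rule AE_not_in) (simp add: negligible_iff_null_sets[symmetric] negligible_frontier_interval)
    ultimately show ?thesis
      unfolding X by eventually_elim (auto simp: indicator_def split: if_splits)
  qed
  then have "AE x in lebesgue. \<forall>X\<in>\<D>. x \<in> X \<longrightarrow> f x = 0"
    by (rule AE_ball_countable'[OF _ D(1)])
  then have "AE x in lebesgue. x \<in> S \<longrightarrow> f x = 0"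
    by eventually_elim (use D(4) in blast)
  then show ?thesis using S by (simp add: AE_restrict_space_iff)
qed

section \<open>Weak gradients\<close>

text \<open>The analogue of \<^const>\<open>partial\<close> for functions with values in a normed space.\<close>

abbreviation dpartial :: "'d \<Rightarrow> (real^'d \<Rightarrow> 'b::real_normed_vector) \<Rightarrow> real^'d \<Rightarrow> 'b" where
  "dpartial i \<phi> x \<equiv> frechet_derivative \<phi> (at x) (axis i 1)"

lemma integrable_lborel_compact_support:
  fixes \<psi> :: "real^'d \<Rightarrow> 'b::euclidean_space"
  assumes "continuous_on UNIV \<psi>" "compact C" "\<And>x. x \<notin> C \<Longrightarrow> \<psi> x = 0"
  shows "integrable lborel \<psi>"
proof -
  have "integrable lborel (\<lambda>x. indicat_real C x *\<^sub>R \<psi> x)"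
    using assms by (intro borel_integrable_compact continuous_on_subset[OF assms(1)]) auto
  also have "(\<lambda>x. indicat_real C x *\<^sub>R \<psi> x) = \<psi>"
    using assms(3) by (auto simp: indicator_def fun_eq_iff)
  finally show ?thesis .
qed

lemma dpartial_outside:
  assumes "closed C" "\<And>x. x \<notin> C \<Longrightarrow> \<psi> x = 0" "x \<notin> C" "\<psi> differentiable at x"
  shows "dpartial i \<psi> x = 0"
proof -
  have "frechet_derivative \<psi> (at x) = frechet_derivative (\<lambda>x. 0) (at x)"
    using assms by (intro frechet_derivative_transform_within_open[of _ _ "- C"]) auto
  then show ?thesis by (simp add: frechet_derivative_const)
qed

text \<open>The integral of a difference quotient \<open>(\<psi> (x + t e) - \<psi> x) / t\<close> vanishes, because Lebesgue
  measure is invariant under translations. The mean value theorem bounds these quotients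
  uniformly on a fixed ball, outside of which they vanish, so dominated convergence applies as
  \<open>t\<close> tends to zero.\<close>

lemma integral_dpartial_eq_0:
  fixes \<psi> :: "real^'d \<Rightarrow> 'b::euclidean_space"
  assumes \<psi>: "Ck 1 \<psi>" and C: "compact C" and out: "\<And>x. x \<notin> C \<Longrightarrow> \<psi> x = 0"
  shows "(\<integral>x. dpartial i \<psi> x \<partial>lborel) = 0"
proof -
  let ?e = "axis i 1 :: real^'d"
  \<comment> \<open>Step sizes at most \<open>1\<close>: all points involved stay in the ball of radius \<open>R + 2\<close>.\<close>
  define t :: "nat \<Rightarrow> real" where "t n = inverse (real (Suc n))" for n
  have t: "0 < t n" "t n \<le> 1" for n by (auto simp: t_def field_simps)
  define Q where "Q n x = (\<psi> (t n *\<^sub>R ?e + x) - \<psi> x) /\<^sub>R t n" for n x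
  have D: "(\<psi> has_derivative frechet_derivative \<psi> (at x)) (at x)" for x
    using \<psi> by (simp add: frechet_derivative_works[symmetric])
  have cont: "continuous_on UNIV \<psi>" "continuous_on UNIV (dpartial i \<psi>)"
    using \<psi> Ck_continuous[OF \<psi>] by simp_all
  then have [measurable]: "\<psi> \<in> borel_measurable borel" "dpartial i \<psi> \<in> borel_measurable borel"
    by (auto intro: borel_measurable_continuous_onI)
  have int: "integrable lborel \<psi>"
    using cont(1) C out by (rule integrable_lborel_compact_support)
  have shift: "integrable lborel (\<lambda>x. \<psi> (c + x))" "(\<integral>x. \<psi> (c + x) \<partial>lborel) = integral\<^sup>L lborel \<psi>" for c
    using integrable_distr_eq[of "(+) c" lborel borel \<psi>] integral_distr[of "(+) c" lborel borel \<psi>] int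
    by (simp_all add: lborel_distr_plus)
  have Q0: "integral\<^sup>L lborel (Q n) = 0" for n
    using int shift by (simp add: Q_def[abs_def])
  obtain R where R: "R > 0" "\<And>x. x \<in> C \<Longrightarrow> norm x \<le> R"
    using compact_imp_bounded[OF C] unfolding bounded_pos by blast
  have "bounded (dpartial i \<psi> ` cball 0 (R + 2))"
    using cont(2) by (intro compact_imp_bounded compact_continuous_image) (auto intro: continuous_on_subset)
  then obtain B where B: "\<And>x. norm x \<le> R + 2 \<Longrightarrow> norm (dpartial i \<psi> x) \<le> B"
    unfolding bounded_iff by (metis image_eqI mem_cball_0)
  have line: "((\<lambda>s. \<psi> (x + s *\<^sub>R ?e)) has_derivative (\<lambda>h. h *\<^sub>R dpartial i \<psi> (x + s *\<^sub>R ?e))) (at s)" for x s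
  proof -
    have "((\<lambda>s. x + s *\<^sub>R ?e) has_derivative (\<lambda>h. h *\<^sub>R ?e)) (at s)"
      by (auto intro!: derivative_eq_intros)
    from has_derivative_compose[OF this D]
    show ?thesis
      using has_derivative_linear[OF D] by (simp add: linear_cmul)
  qed
  have normQ: "norm (Q n x) = norm (\<psi> (x + t n *\<^sub>R ?e) - \<psi> x) / t n" for n x
    using t(1)[of n] by (simp add: Q_def add.commute divide_inverse mult.commute)
  have Qb: "norm (Q n x) \<le> indicat_real (cball 0 (R + 1)) x * B" for n x
  proof (cases "norm x \<le> R + 1")
    case True
    have "continuous_on {0..t n} (\<lambda>s. \<psi> (x + s *\<^sub>R ?e))"
      by (intro has_derivative_continuous_on[OF has_derivative_at_withinI[OF line]])
    from mvt_general[OF t(1) this line] obtain s where s: "0 < s" "s < t n"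
        "norm (\<psi> (x + t n *\<^sub>R ?e) - \<psi> (x + 0 *\<^sub>R ?e)) \<le> norm ((t n - 0) *\<^sub>R dpartial i \<psi> (x + s *\<^sub>R ?e))"
      by auto
    have "norm (x + s *\<^sub>R ?e) \<le> norm x + s"
      using norm_triangle_ineq[of x "s *\<^sub>R ?e"] s by simp
    then have "norm (dpartial i \<psi> (x + s *\<^sub>R ?e)) \<le> B"
      using True s t(2)[of n] by (intro B) linarith
    then have "norm (\<psi> (x + t n *\<^sub>R ?e) - \<psi> x) \<le> t n * B"
      using s(3) t(1)[of n] by (simp add: mult_left_mono order_trans)
    then show ?thesis
      using True t(1)[of n] by (simp add: normQ pos_divide_le_eq mult.commute)
  next
    case False
    have "norm x \<le> norm (t n *\<^sub>R ?e + x) + t n"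
      using norm_triangle_ineq4[of "t n *\<^sub>R ?e + x" "t n *\<^sub>R ?e"] t(1)[of n] by simp
    then have "x \<notin> C" "t n *\<^sub>R ?e + x \<notin> C"
      using R False t[of n] by fastforce+
    then show ?thesis using False by (simp add: Q_def out)
  qed
  have "(\<lambda>n. integral\<^sup>L lborel (Q n)) \<longlonglongrightarrow> (\<integral>x. dpartial i \<psi> x \<partial>lborel)"
  proof (rule integral_dominated_convergence[where w = "\<lambda>x. indicat_real (cball 0 (R + 1)) x * B"])
    show "integrable lborel (\<lambda>x :: real^'d. indicat_real (cball 0 (R + 1)) x * B)"
      by (intro integrable_mult_left integrable_real_indicator emeasure_compact_finite) simp_all
    show "AE x in lborel. (\<lambda>n. Q n x) \<longlonglongrightarrow> dpartial i \<psi> x"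
    proof (rule AE_I2)
      fix x
      have "t \<longlonglongrightarrow> 0"
        unfolding t_def by (rule LIMSEQ_inverse_real_of_nat)
      then have "filterlim (\<lambda>n. t n) (at 0) sequentially"
        using t(1) by (auto simp: filterlim_at less_imp_neq[symmetric])
      moreover have "((\<lambda>h. norm (\<psi> (x + (0 + h) *\<^sub>R ?e) - \<psi> (x + 0 *\<^sub>R ?e)
          - h *\<^sub>R dpartial i \<psi> (x + 0 *\<^sub>R ?e)) / norm h) \<longlongrightarrow> 0) (at 0)"
        using line[of x 0] unfolding has_derivative_at by blast
      ultimately have "(\<lambda>n. norm (\<psi> (x + (0 + t n) *\<^sub>R ?e) - \<psi> (x + 0 *\<^sub>R ?e)
          - t n *\<^sub>R dpartial i \<psi> (x + 0 *\<^sub>R ?e)) / norm (t n)) \<longlonglongrightarrow> 0"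
        by (rule filterlim_compose[rotated])
      moreover have "norm (\<psi> (x + (0 + t n) *\<^sub>R ?e) - \<psi> (x + 0 *\<^sub>R ?e)
          - t n *\<^sub>R dpartial i \<psi> (x + 0 *\<^sub>R ?e)) / norm (t n) = norm (Q n x - dpartial i \<psi> x)" for n
      proof -
        have "Q n x - dpartial i \<psi> x = (\<psi> (x + t n *\<^sub>R ?e) - \<psi> x - t n *\<^sub>R dpartial i \<psi> x) /\<^sub>R t n"
          using t(1)[of n] by (simp add: Q_def add.commute scaleR_diff_right)
        then show ?thesis using t(1)[of n] by (simp add: divide_inverse mult.commute)
      qed
      ultimately show "(\<lambda>n. Q n x) \<longlonglongrightarrow> dpartial i \<psi> x"
        by (simp add: LIM_zero_iff tendsto_norm_zero_iff)
    qed
    show "Q n \<in> borel_measurable lborel" for n unfolding Q_def by measurable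
    show "AE x in lborel. norm (Q n x) \<le> indicat_real (cball 0 (R + 1)) x * B" for n
      using Qb by simp
  qed simp
  with Q0 show ?thesis by (simp add: LIMSEQ_const_iff)
qed

lemma continuous_imp_locally_integrable:
  fixes f :: "real^'d \<Rightarrow> 'b::euclidean_space"
  assumes "continuous_on UNIV f"
  shows "locally_integrable S f"
  unfolding locally_integrable_def set_integrable_def
proof (intro allI impI)
  fix C :: "(real^'d) set"
  assume C: "compact C \<and> C \<subseteq> S"
  then have "integrable lborel (\<lambda>x. indicat_real C x *\<^sub>R f x)"
    using assms by (intro borel_integrable_compact continuous_on_subset[OF assms(1)]) auto
  then show "integrable lebesgue (\<lambda>x. indicat_real C x *\<^sub>R f x)"
    using integrable_completion[of "\<lambda>x. indicat_real C x *\<^sub>R f x" lborel] by auto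
qed

text \<open>A test function is used only through a compact set outside of which the function and its
  derivatives vanish, and through the continuity of its first derivatives.\<close>

lemma test_functionD:
  assumes "test_function S \<phi>"
  obtains C where "compact C" "C \<subseteq> S" "\<And>x. x \<notin> C \<Longrightarrow> \<phi> x = 0" "\<And>x i. x \<notin> C \<Longrightarrow> partial i \<phi> x = 0"
    "Ck 1 \<phi>" "continuous_on UNIV \<phi>" "\<And>i. continuous_on UNIV (partial i \<phi>)"
proof
  let ?C = "closure {x. \<phi> x \<noteq> 0}"
  show 0: "\<phi> x = 0" if "x \<notin> ?C" for x
    using that subsetD[OF closure_subset, of x "{x. \<phi> x \<noteq> 0}"] by auto
  show 1: "Ck 1 \<phi>" using assms by (simp add: test_function_def Cinf_def)
  show "partial i \<phi> x = 0" if "x \<notin> ?C" for x i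
    unfolding partial_def using 1 by (intro dpartial_outside[OF _ 0 that]) auto
  show "continuous_on UNIV \<phi>" using 1 by (rule Ck_continuous)
  show "continuous_on UNIV (partial i \<phi>)" for i
    using 1 by (simp add: partial_def[abs_def])
qed (use assms in \<open>auto simp: test_function_def\<close>)

lemma integral_lebesgue_on_support:
  fixes f :: "real^'d \<Rightarrow> 'b::euclidean_space"
  assumes "S \<in> sets lebesgue" "\<And>x. x \<notin> S \<Longrightarrow> f x = 0"
  shows "integral\<^sup>L (lebesgue_on S) f = integral\<^sup>L lebesgue f"
proof -
  have "(\<lambda>x. indicat_real S x *\<^sub>R f x) = f"
    using assms(2) by (auto simp: indicator_def fun_eq_iff)
  with assms(1) show ?thesis by (simp add: integral_restrict_space)
qed

text \<open>Integration by parts: the product of \<open>w\<close> and a test function has compact support, so the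
  integral of each of its partial derivatives vanishes.\<close>

lemma has_weak_grad_Ck_1:
  fixes w :: "real^'d \<Rightarrow> complex"
  assumes S: "open S" and w: "Ck 1 w"
  shows "has_weak_grad S w (\<lambda>x. \<chi> i. dpartial i w x)"
  unfolding has_weak_grad_def
proof (intro conjI allI impI)
  have cw: "continuous_on UNIV w" "\<And>i. continuous_on UNIV (dpartial i w)"
    using w Ck_continuous[OF w] by simp_all
  then show "locally_integrable S w" "locally_integrable S (\<lambda>x. \<chi> i. dpartial i w x)"
    by (auto intro!: continuous_imp_locally_integrable continuous_on_vec_lambda)
  fix \<phi> i
  assume "test_function S \<phi>"
  then obtain C where C: "compact C" "C \<subseteq> S" "\<And>x. x \<notin> C \<Longrightarrow> \<phi> x = 0"
      "\<And>x i. x \<notin> C \<Longrightarrow> partial i \<phi> x = 0"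
    "Ck 1 \<phi>" "continuous_on UNIV \<phi>" "\<And>i. continuous_on UNIV (partial i \<phi>)"
    by (rule test_functionD) blast
  let ?f = "\<lambda>x. partial i \<phi> x *\<^sub>R w x" and ?g = "\<lambda>x. \<phi> x *\<^sub>R dpartial i w x"
  have c: "continuous_on UNIV ?f" "continuous_on UNIV ?g"
    by (intro continuous_intros C cw)+
  have D: "((\<lambda>x. \<phi> x *\<^sub>R w x) has_derivative
      (\<lambda>h. \<phi> x *\<^sub>R frechet_derivative w (at x) h + frechet_derivative \<phi> (at x) h *\<^sub>R w x)) (at x)" for x
    using C(5) w by (intro has_derivative_scaleR) (auto simp: frechet_derivative_works[symmetric])
  have d: "dpartial j (\<lambda>x. \<phi> x *\<^sub>R w x) x = \<phi> x *\<^sub>R dpartial j w x + partial j \<phi> x *\<^sub>R w x" for j x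
    by (simp add: frechet_derivative_at[OF D, symmetric] partial_def)
  have "Ck 1 (\<lambda>x. \<phi> x *\<^sub>R w x)"
    using D by (auto simp: d differentiable_def intro!: continuous_intros C cw)
  then have "(\<integral>x. dpartial i (\<lambda>x. \<phi> x *\<^sub>R w x) x \<partial>lborel) = 0"
    by (rule integral_dpartial_eq_0[OF _ C(1)]) (simp add: C)
  then have "(\<integral>x. ?g x + ?f x \<partial>lborel) = 0"
    by (simp add: d)
  moreover have "integrable lborel ?f" "integrable lborel ?g"
    using C by (auto intro!: integrable_lborel_compact_support[OF c(1) C(1)]
        integrable_lborel_compact_support[OF c(2) C(1)])
  ultimately have "integral\<^sup>L lborel ?f = - integral\<^sup>L lborel ?g"
    by (simp add: add_eq_0_iff)
  moreover have "integral\<^sup>L (lebesgue_on S) h = integral\<^sup>L lborel h"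
    if "continuous_on UNIV h" "\<And>x. x \<notin> S \<Longrightarrow> h x = 0" for h :: "real^'d \<Rightarrow> complex"
    using integral_lebesgue_on_support[of S h] S that
      integral_completion[of h lborel] borel_measurable_continuous_onI[OF that(1)] by simp
  note this[OF c(1)] this[OF c(2)]
  moreover have "?f x = 0" "?g x = 0" if "x \<notin> S" for x
    using C(2-4) that by (auto dest: subsetD)
  ultimately show "integral\<^sup>L (lebesgue_on S) ?f = - (\<integral>x. \<phi> x *\<^sub>R (\<chi> i. dpartial i w x) $ i \<partial>lebesgue_on S)"
    by simp
qed

lemma integrable_test_times:
  fixes f :: "real^'d \<Rightarrow> 'b::euclidean_space"
  assumes S: "open S" and f: "locally_integrable S f" and \<theta>: "continuous_on UNIV \<theta>"
    and C: "compact C" "C \<subseteq> S" and out: "\<And>x. x \<notin> C \<Longrightarrow> \<theta> x = 0"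
  shows "integrable (lebesgue_on S) (\<lambda>x. \<theta> x *\<^sub>R f x)"
proof -
  have "bounded (\<theta> ` C)"
    using \<theta> C(1) by (intro compact_imp_bounded compact_continuous_image) (auto intro: continuous_on_subset)
  then obtain B where B: "\<And>x. x \<in> C \<Longrightarrow> \<bar>\<theta> x\<bar> \<le> B"
    unfolding bounded_iff by auto
  let ?g = "\<lambda>x. indicat_real C x *\<^sub>R f x"
  have g: "integrable lebesgue ?g"
    using f C by (simp add: locally_integrable_def set_integrable_def)
  have "integrable lebesgue (\<lambda>x. \<theta> x *\<^sub>R ?g x)"
  proof (rule Bochner_Integration.integrable_bound)
    show "integrable lebesgue (\<lambda>x. B *\<^sub>R norm (?g x))"
      using g by (intro integrable_scaleR_right integrable_norm)
    have "\<theta> \<in> borel_measurable lebesgue"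
      using borel_measurable_continuous_onI[OF \<theta>] by (simp add: measurable_completion)
    then show "(\<lambda>x. \<theta> x *\<^sub>R ?g x) \<in> borel_measurable lebesgue"
      using borel_measurable_integrable[OF g] by (rule borel_measurable_scaleR)
    show "AE x in lebesgue. norm (\<theta> x *\<^sub>R ?g x) \<le> norm (B *\<^sub>R norm (?g x))"
    proof (rule AE_I2)
      fix x
      show "norm (\<theta> x *\<^sub>R ?g x) \<le> norm (B *\<^sub>R norm (?g x))"
        using B[of x] by (cases "x \<in> C") (auto intro!: mult_right_mono)
    qed
  qed
  also have "(\<lambda>x. \<theta> x *\<^sub>R ?g x) = (\<lambda>x. indicat_real S x *\<^sub>R (\<theta> x *\<^sub>R f x))"
  proof
    fix x
    show "\<theta> x *\<^sub>R ?g x = indicat_real S x *\<^sub>R (\<theta> x *\<^sub>R f x)"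
      using C out[of x] by (cases "x \<in> C") auto
  qed
  finally show ?thesis using S by (simp add: integrable_restrict_space)
qed

lemma locally_integrable_diff:
  fixes f g :: "real^'d \<Rightarrow> 'b::euclidean_space"
  assumes "locally_integrable S f" "locally_integrable S g"
  shows "locally_integrable S (\<lambda>x. f x - g x)"
  using assms unfolding locally_integrable_def by (auto intro: set_integral_diff)

lemma locally_integrable_nth:
  fixes f :: "real^'d \<Rightarrow> complex^'d"
  assumes "locally_integrable S f"
  shows "locally_integrable S (\<lambda>x. f x $ i)"
  unfolding locally_integrable_def set_integrable_def
proof (intro allI impI)
  fix C :: "(real^'d) set"
  assume "compact C \<and> C \<subseteq> S"
  then have "integrable lebesgue (\<lambda>x. indicat_real C x *\<^sub>R f x)"
    using assms by (auto simp: locally_integrable_def set_integrable_def)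
  from integrable_bounded_linear[OF bounded_linear_vec_nth this, of i]
  show "integrable lebesgue (\<lambda>x. indicat_real C x *\<^sub>R f x $ i)" by simp
qed

lemma has_weak_grad_diff:
  assumes S: "open S" and u: "has_weak_grad S u G" and v: "has_weak_grad S v G'"
  shows "has_weak_grad S (\<lambda>x. u x - v x) (\<lambda>x. G x - G' x)"
  unfolding has_weak_grad_def
proof (intro conjI allI impI)
  show "locally_integrable S (\<lambda>x. u x - v x)" "locally_integrable S (\<lambda>x. G x - G' x)"
    using u v by (auto simp: has_weak_grad_def intro: locally_integrable_diff)
  fix \<phi> i
  assume \<phi>: "test_function S \<phi>"
  then obtain C where C: "compact C" "C \<subseteq> S" "\<And>x. x \<notin> C \<Longrightarrow> \<phi> x = 0"
      "\<And>x i. x \<notin> C \<Longrightarrow> partial i \<phi> x = 0"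
    "Ck 1 \<phi>" "continuous_on UNIV \<phi>" "\<And>i. continuous_on UNIV (partial i \<phi>)"
    by (rule test_functionD) blast
  have "integrable (lebesgue_on S) (\<lambda>x. partial i \<phi> x *\<^sub>R f x)" if "locally_integrable S f" for f :: "real^'a \<Rightarrow> complex"
    by (rule integrable_test_times[OF S that C(7) C(1,2,4)])
  moreover have "integrable (lebesgue_on S) (\<lambda>x. \<phi> x *\<^sub>R f x)" if "locally_integrable S f" for f :: "real^'a \<Rightarrow> complex"
    by (rule integrable_test_times[OF S that C(6) C(1,2,3)])
  moreover have "locally_integrable S u" "locally_integrable S v"
     "locally_integrable S (\<lambda>x. G x $ i)" "locally_integrable S (\<lambda>x. G' x $ i)"
    using u v by (auto simp: has_weak_grad_def intro: locally_integrable_nth)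
  moreover have "(\<integral>x. partial i \<phi> x *\<^sub>R u x \<partial>lebesgue_on S) = - (\<integral>x. \<phi> x *\<^sub>R G x $ i \<partial>lebesgue_on S)"
     "(\<integral>x. partial i \<phi> x *\<^sub>R v x \<partial>lebesgue_on S) = - (\<integral>x. \<phi> x *\<^sub>R G' x $ i \<partial>lebesgue_on S)"
    using u v \<phi> by (auto simp: has_weak_grad_def)
  ultimately show "(\<integral>x. partial i \<phi> x *\<^sub>R (u x - v x) \<partial>lebesgue_on S)
      = - (\<integral>x. \<phi> x *\<^sub>R (G x - G' x) $ i \<partial>lebesgue_on S)"
    by (simp add: scaleR_diff_right)
qed

text \<open>The difference of two weak gradients is a weak gradient of \<open>0\<close>, so the fundamental lemma
  applies to each of its components.\<close>

lemma weak_grad_unique: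
  assumes S: "open S" and G: "has_weak_grad S u G" and G': "has_weak_grad S u G'"
  shows "AE x in lebesgue_on S. G x = G' x"
proof -
  have d: "has_weak_grad S (\<lambda>x. 0) (\<lambda>x. G x - G' x)"
    using has_weak_grad_diff[OF S G G'] by simp
  have "AE x in lebesgue_on S. (G x - G' x) $ i = 0" for i
  proof (rule fundamental_lemma_calculus_of_variations[OF S])
    show "locally_integrable S (\<lambda>x. (G x - G' x) $ i)"
      using d by (intro locally_integrable_nth) (simp add: has_weak_grad_def)
    show "(\<integral>x. \<phi> x *\<^sub>R (G x - G' x) $ i \<partial>lebesgue_on S) = 0" if "test_function S \<phi>" for \<phi>
      using d that by (simp add: has_weak_grad_def)
  qed
  then have "AE x in lebesgue_on S. \<forall>i. (G x - G' x) $ i = 0"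
    by (simp add: AE_all_countable)
  then show ?thesis
    by eventually_elim (simp add: vec_eq_iff)
qed

lemma test_function_mono: "test_function T \<phi> \<Longrightarrow> T \<subseteq> S \<Longrightarrow> test_function S \<phi>"
  by (auto simp: test_function_def)

lemma has_weak_grad_subset:
  assumes S: "open S" and T: "open T" "T \<subseteq> S" and u: "has_weak_grad S u G"
  shows "has_weak_grad T u G"
  unfolding has_weak_grad_def
proof (intro conjI allI impI)
  show "locally_integrable T u" "locally_integrable T G"
    using u T(2) by (auto simp: has_weak_grad_def locally_integrable_def)
  fix \<phi> i
  assume \<phi>: "test_function T \<phi>"
  then obtain C where C: "compact C" "C \<subseteq> T" "\<And>x. x \<notin> C \<Longrightarrow> \<phi> x = 0"
      "\<And>x i. x \<notin> C \<Longrightarrow> partial i \<phi> x = 0"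
    by (rule test_functionD) blast
  have 0: "\<phi> x = 0" "partial i \<phi> x = 0" if "x \<notin> T" for x i
    using C that by auto
  have "(\<integral>x. partial i \<phi> x *\<^sub>R u x \<partial>lebesgue_on S) = - (\<integral>x. \<phi> x *\<^sub>R G x $ i \<partial>lebesgue_on S)"
    using u test_function_mono[OF \<phi> T(2)] by (simp add: has_weak_grad_def)
  moreover have "integral\<^sup>L (lebesgue_on S) f = integral\<^sup>L (lebesgue_on T) f"
    if "\<And>x. x \<notin> T \<Longrightarrow> f x = 0" for f :: "real^'a \<Rightarrow> complex"
    using integral_lebesgue_on_support[of S f] integral_lebesgue_on_support[of T f] that S T by auto
  ultimately show "(\<integral>x. partial i \<phi> x *\<^sub>R u x \<partial>lebesgue_on T) = - (\<integral>x. \<phi> x *\<^sub>R G x $ i \<partial>lebesgue_on T)"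
    using 0 by simp
qed

lemma wgrad_has_weak_grad: "has_weak_grad S u G \<Longrightarrow> has_weak_grad S u (wgrad S u)"
  unfolding wgrad_def by (rule someI[of "has_weak_grad S u"])

lemma wgrad_AE_eq:
  assumes "open S" "has_weak_grad S u G"
  shows "AE x in lebesgue_on S. wgrad S u x = G x"
  using assms weak_grad_unique wgrad_has_weak_grad by blast

section \<open>Square integrability\<close>

lemma l2norm_power2: "(l2norm M f)\<^sup>2 = (\<integral>x. (norm (f x))\<^sup>2 \<partial>M)"
  by (simp add: l2norm_def)

lemma square_norm_diff_le:
  fixes a b :: "'b::real_normed_vector"
  shows "(norm (a - b))\<^sup>2 \<le> 2 * (norm a)\<^sup>2 + 2 * (norm b)\<^sup>2"
proof -
  have "(norm (a - b))\<^sup>2 \<le> (norm a + norm b)\<^sup>2"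
    by (intro power_mono norm_triangle_ineq4) simp
  also have "\<dots> \<le> 2 * (norm a)\<^sup>2 + 2 * (norm b)\<^sup>2"
    using sum_squares_bound[of "norm a" "norm b"] by (simp add: power2_sum)
  finally show ?thesis .
qed

lemma L2_diff:
  fixes f g :: "'a \<Rightarrow> 'b::euclidean_space"
  assumes f: "L2 M f" and g: "L2 M g"
  shows "L2 M (\<lambda>x. f x - g x)"
  unfolding L2_def
proof
  have m: "f \<in> borel_measurable M" "g \<in> borel_measurable M"
    using f g by (simp_all add: L2_def)
  then show d: "(\<lambda>x. f x - g x) \<in> borel_measurable M"
    by (rule borel_measurable_diff)
  show "integrable M (\<lambda>x. (norm (f x - g x))\<^sup>2)"
  proof (rule Bochner_Integration.integrable_bound)
    show "integrable M (\<lambda>x. 2 * (norm (f x))\<^sup>2 + 2 * (norm (g x))\<^sup>2)"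
      using f g by (simp add: L2_def)
    show "(\<lambda>x. (norm (f x - g x))\<^sup>2) \<in> borel_measurable M"
      using d by simp
  qed (simp add: square_norm_diff_le)
qed

lemma L2_uminus: "L2 M f \<Longrightarrow> L2 M (\<lambda>x. - f x)"
  by (simp add: L2_def)

lemma L2_add: "L2 M f \<Longrightarrow> L2 M g \<Longrightarrow> L2 M (\<lambda>x. f x + g x)"
  using L2_diff[of M f "\<lambda>x. - g x"] by (simp add: L2_uminus)

lemma integrable_L2_product:
  fixes f :: "'a \<Rightarrow> 'b::euclidean_space" and g :: "'a \<Rightarrow> 'c::euclidean_space"
    and h :: "'a \<Rightarrow> 'e::euclidean_space"
  assumes f: "L2 M f" and g: "L2 M g" and h: "h \<in> borel_measurable M"
    and le: "\<And>x. norm (h x) \<le> norm (f x) * norm (g x)"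
  shows "integrable M h"
proof (rule Bochner_Integration.integrable_bound[OF _ h])
  show "integrable M (\<lambda>x. (norm (f x))\<^sup>2 + (norm (g x))\<^sup>2)"
    using f g by (simp add: L2_def)
  show "AE x in M. norm (h x) \<le> norm ((norm (f x))\<^sup>2 + (norm (g x))\<^sup>2)"
  proof (rule AE_I2)
    fix x
    have "norm (h x) \<le> norm (f x) * norm (g x)" by (rule le)
    also have "\<dots> \<le> (norm (f x))\<^sup>2 + (norm (g x))\<^sup>2"
      using sum_squares_bound[of "norm (f x)" "norm (g x)"]
        mult_nonneg_nonneg[OF norm_ge_zero[of "f x"] norm_ge_zero[of "g x"]] by linarith
    finally show "norm (h x) \<le> norm ((norm (f x))\<^sup>2 + (norm (g x))\<^sup>2)" by simp
  qed
qed

lemma integrable_L2_inner: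
  fixes f g :: "'a \<Rightarrow> 'b::euclidean_space"
  assumes "L2 M f" "L2 M g"
  shows "integrable M (\<lambda>x. f x \<bullet> g x)"
  using assms by (intro integrable_L2_product[OF assms]) (auto simp: L2_def Cauchy_Schwarz_ineq2)

lemma borel_measurable_cnj: "f \<in> borel_measurable M \<Longrightarrow> (\<lambda>x. cnj (f x)) \<in> borel_measurable M"
  by (rule borel_measurable_continuous_on[OF linear_continuous_on[OF bounded_linear_cnj]])

lemma Re_ip:
  assumes f: "L2 M f" and g: "L2 M g"
  shows "Re (ip M f g) = (\<integral>x. f x \<bullet> g x \<partial>M)"
proof -
  have "integrable M (\<lambda>x. f x * cnj (g x))"
    using f g by (intro integrable_L2_product[OF f g]) (auto simp: L2_def norm_mult borel_measurable_cnj borel_measurable_times)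
  then show ?thesis
    by (simp add: ip_def integral_Re[symmetric] inner_complex_def)
qed

lemma Re_ipv:
  fixes f g :: "'a \<Rightarrow> complex^'d"
  assumes f: "L2 M f" and g: "L2 M g"
  shows "Re (ipv M f g) = (\<integral>x. f x \<bullet> g x \<partial>M)"
proof -
  have m: "(\<lambda>x. f x $ i) \<in> borel_measurable M" "(\<lambda>x. g x $ i) \<in> borel_measurable M" for i
    using f g borel_measurable_continuous_on[OF linear_continuous_on[OF bounded_linear_vec_nth]]
    by (auto simp: L2_def)
  have "integrable M (\<lambda>x. f x $ i * cnj (g x $ i))" for i
    by (intro integrable_L2_product[OF f g])
      (auto simp: norm_mult m intro!: mult_mono Finite_Cartesian_Product.norm_nth_le borel_measurable_times borel_measurable_cnj)
  then have "integrable M (\<lambda>x. \<Sum>i\<in>UNIV. f x $ i * cnj (g x $ i))"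
    by (intro Bochner_Integration.integrable_sum)
  then show ?thesis
    by (simp add: ipv_def integral_Re[symmetric] inner_vec_def inner_complex_def)
qed

lemma l2norm_diff_le:
  fixes f g h :: "'a \<Rightarrow> 'b::euclidean_space"
  assumes f: "L2 M f" and g: "L2 M g" and h: "L2 M h" and eq: "AE x in M. h x = f x - g x"
  shows "(l2norm M h)\<^sup>2 \<le> 2 * (l2norm M f)\<^sup>2 + 2 * (l2norm M g)\<^sup>2"
proof -
  have i: "integrable M (\<lambda>x. (norm (f x))\<^sup>2)" "integrable M (\<lambda>x. (norm (g x))\<^sup>2)"
      "integrable M (\<lambda>x. (norm (h x))\<^sup>2)"
    using f g h by (simp_all add: L2_def)
  have "(\<integral>x. (norm (h x))\<^sup>2 \<partial>M) \<le> (\<integral>x. 2 * (norm (f x))\<^sup>2 + 2 * (norm (g x))\<^sup>2 \<partial>M)"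
    using eq by (intro integral_mono_AE) (auto simp: i square_norm_diff_le elim!: eventually_mono)
  with i show ?thesis by (simp add: l2norm_power2)
qed

text \<open>Measurability survives a change on a null set since restrictions of Lebesgue measure are
  complete.\<close>

lemma L2_cong_AE:
  fixes f g :: "real^'d \<Rightarrow> 'b::euclidean_space"
  assumes S: "S \<in> sets lebesgue" and f: "L2 (lebesgue_on S) f"
    and eq: "AE x in lebesgue_on S. f x = g x"
  shows "L2 (lebesgue_on S) g"
proof -
  have complete: "complete_measure (lebesgue_on S)"
  proof
    fix A B :: "(real^'d) set"
    assume "B \<subseteq> A" "A \<in> null_sets (lebesgue_on S)"
    with S have "A \<subseteq> S" "B \<in> null_sets lebesgue"
      using completion.complete2[of B A lborel] by (auto simp: null_sets_restrict_space)
    with S \<open>B \<subseteq> A\<close> show "B \<in> sets (lebesgue_on S)"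
      by (auto simp: sets_restrict_space_iff dest: null_setsD2)
  qed
  have m: "f \<in> borel_measurable (lebesgue_on S)" "integrable (lebesgue_on S) (\<lambda>x. (norm (f x))\<^sup>2)"
    using f by (simp_all add: L2_def)
  have g: "g \<in> borel_measurable (lebesgue_on S)"
  proof (rule measurableI)
    fix A :: "'b set"
    assume "A \<in> sets borel"
    with m(1) have preimage: "f -` A \<inter> space (lebesgue_on S) \<in> sets (lebesgue_on S)"
      by (rule measurable_sets)
    have "AE x in lebesgue_on S.
        x \<in> f -` A \<inter> space (lebesgue_on S) \<longleftrightarrow> x \<in> g -` A \<inter> space (lebesgue_on S)"
      using eq by eventually_elim auto
    then show "g -` A \<inter> space (lebesgue_on S) \<in> sets (lebesgue_on S)"
      using preimage by (rule complete_measure.in_sets_AE[OF complete]) simp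
  qed simp
  have "integrable (lebesgue_on S) (\<lambda>x. (norm (g x))\<^sup>2)"
    using m(2)
  proof (rule integrable_cong_AE_imp)
    show "(\<lambda>x. (norm (g x))\<^sup>2) \<in> borel_measurable (lebesgue_on S)" using g by simp
    show "AE x in lebesgue_on S. (norm (f x))\<^sup>2 = (norm (g x))\<^sup>2"
      using eq by eventually_elim simp
  qed
  with g show ?thesis by (simp add: L2_def)
qed

lemma L2_lebesgue_on_iff:
  fixes f :: "real^'d \<Rightarrow> 'b::euclidean_space"
  assumes S: "S \<in> sets lebesgue"
  shows "L2 (lebesgue_on S) f \<longleftrightarrow> L2 lebesgue (\<lambda>x. indicat_real S x *\<^sub>R f x)"
proof -
  have "(norm (indicat_real S x *\<^sub>R f x))\<^sup>2 = indicat_real S x *\<^sub>R (norm (f x))\<^sup>2" for x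
    by (simp add: indicator_def)
  with S show ?thesis
    unfolding L2_def
    by (simp only: borel_measurable_restrict_space_iff integrable_restrict_space space_completion
        space_lborel space_borel Int_UNIV_right)
qed

lemma L2_lebesgue_on_subset:
  fixes f :: "real^'d \<Rightarrow> 'b::euclidean_space"
  assumes S: "S \<in> sets lebesgue" and T: "T \<in> sets lebesgue"
    and ST: "AE x in lebesgue_on T. x \<in> S" and f: "L2 (lebesgue_on S) f"
  shows "L2 (lebesgue_on T) f"
proof -
  let ?F = "\<lambda>x. indicat_real S x *\<^sub>R f x"
  have F: "L2 lebesgue ?F" using f S by (simp add: L2_lebesgue_on_iff)
  then have m: "?F \<in> borel_measurable lebesgue" "integrable lebesgue (\<lambda>x. (norm (?F x))\<^sup>2)"
    by (simp_all only: L2_def)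
  have "(norm (indicat_real T x *\<^sub>R ?F x))\<^sup>2 = indicat_real T x *\<^sub>R (norm (?F x))\<^sup>2" for x
    by (simp add: indicator_def)
  then have "L2 lebesgue (\<lambda>x. indicat_real T x *\<^sub>R ?F x)"
    unfolding L2_def
    using borel_measurable_scaleR[OF borel_measurable_indicator[OF T] m(1)]
      integrable_mult_indicator[OF T m(2)] by (simp only: simp_thms)
  then have "L2 (lebesgue_on T) ?F"
    using L2_lebesgue_on_iff[OF T, of ?F] by (simp only:)
  then show ?thesis
    by (rule L2_cong_AE[OF T]) (use ST in \<open>auto elim!: eventually_mono\<close>)
qed

lemma L2_continuous_compact:
  fixes f :: "real^'d \<Rightarrow> 'b::euclidean_space"
  assumes K: "compact K" and f: "continuous_on UNIV f"
  shows "L2 (lebesgue_on K) f"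
  unfolding L2_def
proof
  have K': "K \<in> sets lebesgue"
    using K by (simp add: borel_compact)
  show "f \<in> borel_measurable (lebesgue_on K)"
    using borel_measurable_continuous_onI[OF f]
    by (intro measurable_restrict_space1) (simp add: measurable_completion)
  have "continuous_on UNIV (\<lambda>x. (norm (f x))\<^sup>2)"
    using f by (intro continuous_intros)
  then have "locally_integrable K (\<lambda>x. (norm (f x))\<^sup>2)"
    by (rule continuous_imp_locally_integrable)
  with K K' show "integrable (lebesgue_on K) (\<lambda>x. (norm (f x))\<^sup>2)"
    by (simp add: locally_integrable_def set_integrable_def integrable_restrict_space)
qed

section \<open>Domain and mesh elements\<close>

text \<open>A Lipschitz domain lies locally on one side of its boundary. Moving from a boundary point in
  the direction \<open>e\<close> leads to points strictly above the graph, and these have a neighbourhood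
  disjoint from the domain. Hence no boundary point is interior to the closure, and the interior
  of every mesh element lies in the domain.\<close>

lemma interior_closure_lipschitz_domain:
  fixes S :: "(real^'d) set"
  assumes S: "lipschitz_domain S"
  shows "interior (closure S) \<subseteq> S"
proof
  fix x
  assume x: "x \<in> interior (closure S)"
  have "open S" using S by (simp add: lipschitz_domain_def)
  show "x \<in> S"
  proof (rule ccontr)
    assume "x \<notin> S"
    then have "x \<in> frontier S"
      using x interior_subset[of "closure S"] \<open>open S\<close> by (auto simp: frontier_def interior_open)
    then obtain e :: "real^'d" and \<rho> L \<phi> where e: "norm e = 1" and \<rho>: "\<rho> > 0"
      and lip: "L-lipschitz_on {z. z \<bullet> e = 0} \<phi>"
      and graph: "\<And>y. y \<in> ball x \<rho> \<Longrightarrow> y \<in> S \<longleftrightarrow> y \<bullet> e < \<phi> (y - (y \<bullet> e) *\<^sub>R e)"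
      using S unfolding lipschitz_domain_def by metis
    define P where "P y = y - (y \<bullet> e) *\<^sub>R e" for y
    have ee: "e \<bullet> e = 1" using e by (simp add: dot_square_norm)
    have P: "P y \<bullet> e = 0" for y
      by (simp add: P_def inner_diff_left ee)
    have "continuous_on UNIV (\<lambda>y. \<phi> (P y))"
    proof (rule continuous_on_compose2[OF lipschitz_on_continuous_on[OF lip]])
      show "continuous_on UNIV P" unfolding P_def by (intro continuous_intros)
    qed (auto simp: P)
    then have "open {y. \<phi> (P y) < y \<bullet> e}"
      by (intro open_Collect_less continuous_intros)
    moreover have V: "open (interior (closure S) \<inter> ball x \<rho>)" by auto
    ultimately have open_U: "open (interior (closure S) \<inter> ball x \<rho> \<inter> {y. \<phi> (P y) < y \<bullet> e})" (is "open ?U")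
      by blast
    obtain \<epsilon> where \<epsilon>: "\<epsilon> > 0" "ball x \<epsilon> \<subseteq> interior (closure S) \<inter> ball x \<rho>"
      using V x \<rho> by (metis IntI centre_in_ball openE)
    \<comment> \<open>\<open>x\<close> may lie on the graph itself; the shifted point is strictly above it.\<close>
    define y where "y = x + (\<epsilon> / 2) *\<^sub>R e"
    have "y \<in> ball x \<epsilon>" using \<epsilon>(1) e by (simp add: y_def dist_norm)
    moreover have "\<phi> (P x) \<le> x \<bullet> e"
      using graph[of x] \<open>x \<notin> S\<close> \<rho> by (simp add: P_def)
    moreover have "P y = P x" "y \<bullet> e = x \<bullet> e + \<epsilon> / 2"
      by (simp_all add: P_def y_def inner_add_left ee scaleR_add_left)
    ultimately have "y \<in> ?U" using \<epsilon> by auto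
    moreover have "y \<in> closure S"
      using \<open>y \<in> ?U\<close> interior_subset[of "closure S"] by blast
    ultimately have "?U \<inter> S \<noteq> {}"
      using open_Int_closure_eq_empty[OF open_U, of S] by blast
    then obtain z where "z \<in> ball x \<rho>" "\<phi> (P z) < z \<bullet> e" "z \<in> S" by blast
    with graph[of z] show False by (simp add: P_def)
  qed
qed

lemma AE_lebesgue_on_interior:
  fixes K :: "(real^'d) set"
  assumes "compact K" "convex K"
  shows "AE x in lebesgue_on K. x \<in> interior K"
proof -
  have "AE x in lebesgue. x \<notin> frontier K"
    using negligible_convex_frontier[OF assms(2)] by (intro AE_not_in) (simp add: negligible_iff_null_sets)
  then have "AE x in lebesgue. x \<in> K \<longrightarrow> x \<in> interior K"
    by eventually_elim (use assms(1) in \<open>simp add: frontier_def compact_imp_closed\<close>)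
  with assms show ?thesis by (simp add: AE_restrict_space_iff borel_compact)
qed

lemma AE_lebesgue_on_subset:
  fixes S T :: "(real^'d) set"
  assumes "S \<in> sets lebesgue" "T \<in> sets lebesgue"
    and "AE x in lebesgue_on T. x \<in> S" "AE x in lebesgue_on S. P x"
  shows "AE x in lebesgue_on T. P x"
proof -
  have "AE x in lebesgue. x \<in> T \<longrightarrow> x \<in> S" "AE x in lebesgue. x \<in> S \<longrightarrow> P x"
    using assms by (simp_all add: AE_restrict_space_iff)
  then have "AE x in lebesgue. x \<in> T \<longrightarrow> P x"
    by eventually_elim simp
  with assms(2) show ?thesis by (simp add: AE_restrict_space_iff)
qed

text \<open>By uniqueness, the representative chosen by \<^const>\<open>wgrad\<close> agrees almost everywhere with the
  classical gradient, which is bounded on \<open>K\<close>. The frontier of the convex set \<open>K\<close>, where the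
  representative is arbitrary, is negligible.\<close>

lemma grad_on_Ck_1:
  fixes w :: "real^'d \<Rightarrow> complex"
  assumes K: "compact K" "convex K" and w: "Ck 1 w"
  shows "has_weak_grad (interior K) w (grad_on K w)" "L2 (lebesgue_on K) (grad_on K w)"
proof -
  let ?G = "\<lambda>x. \<chi> i. dpartial i w x"
  have G: "has_weak_grad (interior K) w ?G"
    using w by (intro has_weak_grad_Ck_1) simp_all
  then show "has_weak_grad (interior K) w (grad_on K w)"
    by (rule wgrad_has_weak_grad)
  have K': "K \<in> sets lebesgue" using K(1) by (simp add: borel_compact)
  have "AE x in lebesgue_on (interior K). ?G x = grad_on K w x"
    using wgrad_AE_eq[OF open_interior G] by (simp add: eq_commute)
  then have eq: "AE x in lebesgue_on K. ?G x = grad_on K w x"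
    using AE_lebesgue_on_subset[OF _ K' AE_lebesgue_on_interior[OF K]] by simp
  have "L2 (lebesgue_on K) ?G"
    using w by (intro L2_continuous_compact K(1) continuous_on_vec_lambda) simp
  then show "L2 (lebesgue_on K) (grad_on K w)"
    using eq by (rule L2_cong_AE[OF K'])
qed

section \<open>Bound for the local residual\<close>

text \<open>Young's inequality turns both terms on the right of \<open>test\<close> into half the squares of their
  factors; half of the left-hand side is then absorbed.\<close>

lemma residual_norm_le:
  fixes r B :: "'a \<Rightarrow> complex" and R A :: "'a \<Rightarrow> complex^'d"
  assumes L2: "L2 M r" "L2 M R" "L2 M A" "L2 M B" and s: "s = 1 \<or> s = -1"
    and test: "\<omega>\<^sup>2 * (\<integral>x. r x \<bullet> r x \<partial>M) + (\<integral>x. R x \<bullet> R x \<partial>M)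
      = - (\<integral>x. A x \<bullet> R x \<partial>M) + s * \<omega>\<^sup>2 * (\<integral>x. B x \<bullet> r x \<partial>M)"
  shows "\<omega>\<^sup>2 * (l2norm M r)\<^sup>2 + (l2norm M R)\<^sup>2 \<le> (l2norm M A)\<^sup>2 + \<omega>\<^sup>2 * (l2norm M B)\<^sup>2"
proof -
  have sq: "(l2norm M f)\<^sup>2 = (\<integral>x. f x \<bullet> f x \<partial>M)" for f :: "'a \<Rightarrow> 'e::euclidean_space"
    by (simp add: l2norm_power2 dot_square_norm)
  have young: "- (\<integral>x. f x \<bullet> g x \<partial>M) \<le> ((\<integral>x. f x \<bullet> f x \<partial>M) + (\<integral>x. g x \<bullet> g x \<partial>M)) / 2"
      "(\<integral>x. f x \<bullet> g x \<partial>M) \<le> ((\<integral>x. f x \<bullet> f x \<partial>M) + (\<integral>x. g x \<bullet> g x \<partial>M)) / 2"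
    if "L2 M f" "L2 M g" for f g :: "'a \<Rightarrow> 'e::euclidean_space"
  proof -
    note i = integrable_L2_inner[OF that] integrable_L2_inner[OF that(1,1)] integrable_L2_inner[OF that(2,2)]
    have "0 \<le> (\<integral>x. (f x + g x) \<bullet> (f x + g x) \<partial>M)" "0 \<le> (\<integral>x. (f x - g x) \<bullet> (f x - g x) \<partial>M)"
      by (simp_all add: integral_nonneg)
    then show "- (\<integral>x. f x \<bullet> g x \<partial>M) \<le> ((\<integral>x. f x \<bullet> f x \<partial>M) + (\<integral>x. g x \<bullet> g x \<partial>M)) / 2"
      "(\<integral>x. f x \<bullet> g x \<partial>M) \<le> ((\<integral>x. f x \<bullet> f x \<partial>M) + (\<integral>x. g x \<bullet> g x \<partial>M)) / 2"
      using i by (simp_all add: inner_add_left inner_add_right inner_diff_left inner_diff_right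
          inner_commute[of "g _" "f _"])
  qed
  have "s * (\<integral>x. B x \<bullet> r x \<partial>M) \<le> ((\<integral>x. B x \<bullet> B x \<partial>M) + (\<integral>x. r x \<bullet> r x \<partial>M)) / 2"
    using s young[OF L2(4,1)] by auto
  then have "\<omega>\<^sup>2 * (s * (\<integral>x. B x \<bullet> r x \<partial>M)) \<le> \<omega>\<^sup>2 * (((\<integral>x. B x \<bullet> B x \<partial>M) + (\<integral>x. r x \<bullet> r x \<partial>M)) / 2)"
    by (rule mult_left_mono) simp
  with young(1)[OF L2(3,2)] test show ?thesis
    by (simp add: sq algebra_simps)
qed

text \<open>The residual \<open>r\<close> is an admissible test function in the first local equation, which reads
  \<open>(r, v)\<^sub>1 = -(q\<^sub>h + \<nabla>\<nu>, \<nabla>v) + s \<omega>\<^sup>2 (u\<^sub>h - \<nu>, v)\<close> once the terms in \<open>\<nu>\<close> are moved to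
  the right.\<close>

lemma saddle_point_residual_le:
  fixes r \<nu> :: "real^'d \<Rightarrow> complex"
  assumes K: "compact K" "convex K" and s: "s = 1 \<or> s = -1"
    and r: "poly_le (p + 2) r" and \<nu>: "Ck 1 \<nu>"
    and uh: "L2 (lebesgue_on K) (uh K)" and qh: "L2 (lebesgue_on K) (qh K)"
    and sp: "local_saddle_point s p \<omega> qh uh K r \<nu>"
  shows "(norm1 \<omega> K r)\<^sup>2 \<le> (l2norm (lebesgue_on K) (\<lambda>x. qh K x + grad_on K \<nu> x))\<^sup>2
     + \<omega>\<^sup>2 * (l2norm (lebesgue_on K) (\<lambda>x. uh K x - \<nu> x))\<^sup>2"
proof -
  let ?M = "lebesgue_on K"
  have Ckr: "Ck 1 r" using r by (rule Ck_poly_le)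
  have L: "L2 ?M r" "L2 ?M \<nu>"
    using Ck_continuous[OF Ckr] Ck_continuous[OF \<nu>] by (simp_all add: L2_continuous_compact K)
  note G = grad_on_Ck_1(2)[OF K Ckr] grad_on_Ck_1(2)[OF K \<nu>]
  have "ip1 \<omega> K r r + bform s \<omega> K \<nu> r = gform s \<omega> qh uh K r"
    using sp r by (simp add: local_saddle_point_def)
  then have "Re (ip1 \<omega> K r r) + Re (bform s \<omega> K \<nu> r) = Re (gform s \<omega> qh uh K r)"
    by (metis plus_complex.sel(1))
  then have eq: "\<omega>\<^sup>2 * (\<integral>x. r x \<bullet> r x \<partial>?M) + (\<integral>x. grad_on K r x \<bullet> grad_on K r x \<partial>?M)
      + ((\<integral>x. grad_on K \<nu> x \<bullet> grad_on K r x \<partial>?M) + s * \<omega>\<^sup>2 * (\<integral>x. \<nu> x \<bullet> r x \<partial>?M))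
      = - (\<integral>x. qh K x \<bullet> grad_on K r x \<partial>?M) + s * \<omega>\<^sup>2 * (\<integral>x. uh K x \<bullet> r x \<partial>?M)"
    by (simp add: ip1_def bform_def gform_def Re_ip[symmetric] Re_ipv[symmetric] L G uh qh
        flip: of_real_power of_real_mult)
  have split: "(\<integral>x. (qh K x + grad_on K \<nu> x) \<bullet> grad_on K r x \<partial>?M)
      = (\<integral>x. qh K x \<bullet> grad_on K r x \<partial>?M) + (\<integral>x. grad_on K \<nu> x \<bullet> grad_on K r x \<partial>?M)"
    "(\<integral>x. (uh K x - \<nu> x) \<bullet> r x \<partial>?M) = (\<integral>x. uh K x \<bullet> r x \<partial>?M) - (\<integral>x. \<nu> x \<bullet> r x \<partial>?M)"
    using integrable_L2_inner[OF qh G(1)] integrable_L2_inner[OF G(2,1)]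
      integrable_L2_inner[OF uh L(1)] integrable_L2_inner[OF L(2,1)]
    by (simp_all add: inner_add_left inner_diff_left)
  have "\<omega>\<^sup>2 * (\<integral>x. r x \<bullet> r x \<partial>?M) + (\<integral>x. grad_on K r x \<bullet> grad_on K r x \<partial>?M)
      = - (\<integral>x. (qh K x + grad_on K \<nu> x) \<bullet> grad_on K r x \<partial>?M)
        + s * \<omega>\<^sup>2 * (\<integral>x. (uh K x - \<nu> x) \<bullet> r x \<partial>?M)"
    unfolding split using eq by (simp add: algebra_simps)
  from residual_norm_le[OF L(1) G(1) L2_add[OF qh G(2)] L2_diff[OF uh L(2)] s this]
  show ?thesis by (simp add: norm1_def)
qed

section \<open>Local efficiency\<close>

text \<open>Since \<open>q = -\<nabla>u\<close> on \<open>K\<close>, the two discrepancies of the reconstruction split into errors: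
  \<open>q\<^sub>h + \<nabla>\<nu> = -(q - q\<^sub>h) - \<nabla>(u - \<nu>)\<close> and \<open>u\<^sub>h - \<nu> = (u - \<nu>) - (u - u\<^sub>h)\<close>. Squaring costs a factor
  \<open>2\<close>, and the bound of the residual by the same discrepancies costs another one, so the
  squared indicator is at most four times the squared error.\<close>

lemma local_efficiency:
  fixes \<Omega> K :: "(real^'d) set"
  assumes \<Omega>: "open \<Omega>" and u: "H1 \<Omega> u" and q: "L2 (lebesgue_on \<Omega>) q"
    and grad_eq: "AE x in lebesgue_on \<Omega>. q x + wgrad \<Omega> u x = 0"
    and K: "compact K" "convex K" "interior K \<subseteq> \<Omega>"
    and s: "s = 1 \<or> s = -1"
    and r: "poly_le (p + 2) (r K)" and \<nu>: "Ck 1 (\<nu> K)"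
    and uh: "continuous_on UNIV (uh K)" and qh: "continuous_on UNIV (qh K)"
    and sp: "local_saddle_point s p \<omega> qh uh K (r K) (\<nu> K)"
  shows "indicator_eta \<omega> qh uh r \<nu> K \<le> 2 * error_e \<T> \<Gamma>D \<Gamma>R nrm \<omega> u q qh uh \<nu> K"
proof -
  let ?M = "lebesgue_on K"
  let ?N = "grad_on K (\<nu> K)" and ?W = "grad_on K (\<lambda>x. u x - \<nu> K x)"
  have K': "K \<in> sets lebesgue" and \<Omega>': "\<Omega> \<in> sets lebesgue"
    using K(1) \<Omega> by (simp_all add: borel_compact)
  have K\<Omega>: "AE x in ?M. x \<in> \<Omega>"
    using AE_lebesgue_on_interior[OF K(1,2)] by eventually_elim (use K(3) in blast)
  obtain G where G: "has_weak_grad \<Omega> u G" "L2 (lebesgue_on \<Omega>) G" and u\<Omega>: "L2 (lebesgue_on \<Omega>) u"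
    using u unfolding H1_def by (elim conjE exE)
  have G': "has_weak_grad (interior K) u G"
    using has_weak_grad_subset[OF \<Omega> open_interior K(3) G(1)] .
  have flux_K: "AE x in ?M. q x = - G x"
  proof -
    have "AE x in lebesgue_on \<Omega>. q x = - G x"
      using grad_eq wgrad_AE_eq[OF \<Omega> G(1)] by eventually_elim (simp add: add_eq_0_iff2)
    then show ?thesis by (rule AE_lebesgue_on_subset[OF \<Omega>' K' K\<Omega>])
  qed
  have W: "AE x in ?M. ?W x = G x - ?N x"
    using wgrad_AE_eq[OF open_interior has_weak_grad_diff[OF open_interior G' grad_on_Ck_1(1)[OF K(1,2) \<nu>]]]
    by (intro AE_lebesgue_on_subset[OF _ K' AE_lebesgue_on_interior[OF K(1,2)]]) simp_all
  have LG: "L2 ?M G" and Lu: "L2 ?M u" and Lq: "L2 ?M q"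
    using L2_lebesgue_on_subset[OF \<Omega>' K' K\<Omega>] G(2) u\<Omega> q by blast+
  have L\<nu>: "L2 ?M (\<nu> K)" and Luh: "L2 ?M (uh K)" and Lqh: "L2 ?M (qh K)"
    using Ck_continuous[OF \<nu>] uh qh by (simp_all add: L2_continuous_compact K)
  have LN: "L2 ?M ?N" by (rule grad_on_Ck_1(2)[OF K(1,2) \<nu>])
  have LW: "L2 ?M ?W"
    by (rule L2_cong_AE[OF K' L2_diff[OF LG LN]]) (use W in \<open>simp add: eq_commute\<close>)
  have flux_error: "(l2norm ?M (\<lambda>x. qh K x + ?N x))\<^sup>2
      \<le> 2 * (l2norm ?M (\<lambda>x. q x - qh K x))\<^sup>2 + 2 * (l2norm ?M ?W)\<^sup>2"
  proof -
    have "AE x in ?M. - (qh K x + ?N x) = (q x - qh K x) - (- ?W x)"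
      using flux_K W by eventually_elim simp
    from l2norm_diff_le[OF L2_diff[OF Lq Lqh] L2_uminus[OF LW] L2_uminus[OF L2_add[OF Lqh LN]] this]
    show ?thesis by (simp only: l2norm_def norm_minus_cancel)
  qed
  have scalar_error: "(l2norm ?M (\<lambda>x. uh K x - \<nu> K x))\<^sup>2
      \<le> 2 * (l2norm ?M (\<lambda>x. u x - \<nu> K x))\<^sup>2 + 2 * (l2norm ?M (\<lambda>x. u x - uh K x))\<^sup>2"
    by (rule l2norm_diff_le[OF L2_diff[OF Lu L\<nu>] L2_diff[OF Lu Luh] L2_diff[OF Luh L\<nu>]]) simp
  have "(indicator_eta \<omega> qh uh r \<nu> K)\<^sup>2 = (norm1 \<omega> K (r K))\<^sup>2
     + (l2norm ?M (\<lambda>x. qh K x + ?N x))\<^sup>2 + \<omega>\<^sup>2 * (l2norm ?M (\<lambda>x. uh K x - \<nu> K x))\<^sup>2"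
    by (simp add: indicator_eta_def)
  also have "\<dots> \<le> 2 * ((l2norm ?M (\<lambda>x. qh K x + ?N x))\<^sup>2 + \<omega>\<^sup>2 * (l2norm ?M (\<lambda>x. uh K x - \<nu> K x))\<^sup>2)"
    using saddle_point_residual_le[OF K(1,2) s r \<nu> Luh Lqh sp] by simp
  also have "\<dots> \<le> 4 * (\<omega>\<^sup>2 * (l2norm ?M (\<lambda>x. u x - \<nu> K x))\<^sup>2 + (l2norm ?M ?W)\<^sup>2
      + \<omega>\<^sup>2 * (l2norm ?M (\<lambda>x. u x - uh K x))\<^sup>2 + (l2norm ?M (\<lambda>x. q x - qh K x))\<^sup>2)"
    using flux_error mult_left_mono[OF scalar_error zero_le_power2[of \<omega>]] by (simp add: algebra_simps)
  also have "\<dots> = 4 * ((norm1 \<omega> K (\<lambda>x. u x - \<nu> K x))\<^sup>2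
      + \<omega>\<^sup>2 * (l2norm ?M (\<lambda>x. u x - uh K x))\<^sup>2 + (l2norm ?M (\<lambda>x. q x - qh K x))\<^sup>2)"
    by (simp add: norm1_def)
  \<comment> \<open>The error contains the squared jump seminorm as one more nonnegative term.\<close>
  also have "\<dots> \<le> 4 * (error_e \<T> \<Gamma>D \<Gamma>R nrm \<omega> u q qh uh \<nu> K)\<^sup>2"
    by (simp add: error_e_def norm1J_def)
  also have "\<dots> = (2 * error_e \<T> \<Gamma>D \<Gamma>R nrm \<omega> u q qh uh \<nu> K)\<^sup>2"
    by (simp add: power_mult_distrib)
  finally show ?thesis
    by (rule power2_le_imp_le) (simp add: error_e_def)
qed

theorem theorem4p4:
  fixes \<Omega> \<Gamma>D \<Gamma>R :: "(real^'d) set"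
    and H :: "real set" and \<T> :: "real \<Rightarrow> 'd cell set"
    and \<omega> h s :: real and p :: nat
    and f g u :: "real^'d \<Rightarrow> complex" and q :: "real^'d \<Rightarrow> complex^'d"
    and \<tau> :: "'d cell \<Rightarrow> 'd cell \<Rightarrow> real"
    and qh :: "'d broken_vec" and uh uhat r \<nu> :: "'d broken"
    and nrm :: "'d cell \<Rightarrow> real^'d"
  assumes "CARD('d) = 2 \<or> CARD('d) = 3"
    and "lipschitz_domain \<Omega>" and "polyhedral_boundary \<Omega>"
    and "boundary_partition \<Omega> \<Gamma>D \<Gamma>R"
    and "mesh_family \<Omega> \<Gamma>D \<Gamma>R H \<T>" and "shape_regular H \<T>"
    and "p \<ge> 1" and "\<omega> > 0"
    and "L2 (lebesgue_on \<Omega>) f" and "L2 (surface_on \<Gamma>R) g"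
    and "helmholtz_solution \<Omega> \<Gamma>D \<Gamma>R \<omega> f g u q"
    and "h \<in> H"
    and "stabilization (\<T> h) \<tau>"
    and "hdg_solution (\<T> h) \<Gamma>D \<Gamma>R p \<omega> \<tau> f g qh uh uhat"
    and "face_normals (\<T> h) nrm"
    and "s = 1 \<or> s = -1"
    and "broken_poly (p + 2) (\<T> h) r" and "broken_poly (p + 1) (\<T> h) \<nu>"
    and "\<And>K. K \<in> \<T> h \<Longrightarrow> local_saddle_point s p \<omega> qh uh K (r K) (\<nu> K)"
  shows "\<forall>K\<in>\<T> h. indicator_eta \<omega> qh uh r \<nu> K
           \<le> sqrt 6 * error_e (\<T> h) \<Gamma>D \<Gamma>R nrm \<omega> u q qh uh \<nu> K"
proof
  fix K
  assume K: "K \<in> \<T> h"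
  let ?e = "error_e (\<T> h) \<Gamma>D \<Gamma>R nrm \<omega> u q qh uh \<nu> K"
  have mesh: "mesh \<Omega> \<Gamma>D \<Gamma>R (\<T> h)"
    using assms(5,12) by (simp add: mesh_family_def)
  then have "int CARD('d) simplex K"
    using K by (simp add: mesh_def)
  then have K': "compact K" "convex K"
    using simplex_imp_polytope polytope_imp_compact polytope_imp_convex by blast+
  have "K \<subseteq> closure \<Omega>"
    using mesh K by (auto simp: mesh_def)
  then have "interior K \<subseteq> \<Omega>"
    using order_trans[OF interior_mono interior_closure_lipschitz_domain[OF assms(2)]] by simp
  moreover have "continuous_on UNIV (uh K)" "continuous_on UNIV (\<lambda>x. qh K x $ i)" for i
  proof -
    have "poly_le p (uh K)" "poly_le p (\<lambda>x. qh K x $ i)"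
      using assms(14) K
      by (simp_all add: hdg_solution_def broken_poly_def broken_poly_vec_def poly_vec_le_def)
    from this[THEN Ck_poly_le[where k = 0]]
    show "continuous_on UNIV (uh K)" "continuous_on UNIV (\<lambda>x. qh K x $ i)"
      by simp_all
  qed
  moreover from this(2) have "continuous_on UNIV (qh K)"
    using continuous_on_vec_lambda[of UNIV "\<lambda>i x. qh K x $ i"] by simp
  moreover have "poly_le (p + 2) (r K)" "Ck 1 (\<nu> K)"
    using assms(17,18) K Ck_poly_le[of "p + 1" "\<nu> K" 1] unfolding broken_poly_def by blast+
  moreover have "open \<Omega>" "H1 \<Omega> u" "L2 (lebesgue_on \<Omega>) q" "AE x in lebesgue_on \<Omega>. q x + wgrad \<Omega> u x = 0"
    using assms(2,11) by (simp_all add: lipschitz_domain_def helmholtz_solution_def Hdiv_def)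
  ultimately have "indicator_eta \<omega> qh uh r \<nu> K \<le> 2 * ?e"
    using K' assms(16) assms(19)[OF K] by (intro local_efficiency[where \<Omega> = \<Omega> and s = s and p = p])
  also have "\<dots> \<le> sqrt 6 * ?e"
    by (intro mult_right_mono real_le_rsqrt) (simp_all add: error_e_def)
  finally show "indicator_eta \<omega> qh uh r \<nu> K \<le> sqrt 6 * ?e" .
qed

end
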